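(* Let $a_1,a_2$ be integers with $0<a_1\leq a_2-2$ and $a_2\geq 3$, and put $a_1':=\max\{4(a_2-a_1),4a_1\}$. Let $N$ be a positive multiple of $a_1a_2$ with $N\geq 396.59\,a_1'a_2^2(a_2-a_1)^2$. Put $\theta_1=\sqrt{1+\frac{4a_2}{N}}$ and $\theta_2=\sqrt{1+\frac{4a_1}{N}}$. Then $$\lambda:=1+\frac{\log(2.500788\,a_1^{-1}a_1'a_2N)}{\log(0.04216\,a_1^{-1}a_2^{-1}(a_2-a_1)^{-2}N^2)}<2,$$ and for all integers $p_1,p_2,q$ with $q>0$, $$\max\left\{\left|\theta_1-\frac{p_1}{q}\right|,\left|\theta_2-\frac{p_2}{q}\right|\right\}>\frac{a_1}{3.53081\cdot 10^{27}\,a_1'a_2N}\,q^{-\lambda}.$$ *)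

theory Defs
  imports Complex_Main
begin

end

(* Rickert's method of simultaneous Pade approximation, in an elementary form.  Let the nodes be
   a_0 = 0, a_1, a_2, put x = 4/N and A(z) = z (z - a_1) (z - a_2).  The residue of
   (1 + zx)^(k+1/2) / ((z - a_i) A(z)^k) at a_j is sqrt(1 + a_j x) times a rational number p_ij
   whose denominator divides (N a_1 a_2 (a_2 - a_1)^2)^k, because x = 4/N absorbs the powers of 2 in the
   binomial coefficients and a_1 a_2 divides N.  The sum over j of the residues is a power series in x
   that starts at x^(3k), hence is small.

   The matrix (p_ij) is nonsingular: if the rows satisfied a linear relation, then all residues of
   (1 + zx)^(k+1/2) C(z) / A(z)^(k+1) would vanish for some nonzero C of degree at most 2, so by Hermite
   reduction this function would be the derivative of (1 + zx)^(k+3/2) W(z) / A(z)^k for a polynomial W,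
   which comparison of degrees excludes.

   The constants of the theorem leave much room, so crude size estimates suffice and no prime number
   estimates enter. *)
theory Submission
  imports Defs "HOL-Analysis.Analysis" "HOL-Computational_Algebra.Formal_Laurent_Series"
    "HOL-Computational_Algebra.Polynomial_FPS"
begin

unbundle no vec_syntax

section \<open>Residues of rational functions at their poles\<close>

text \<open>Residues are taken in the field of formal Laurent series, so neither contour integrals
  nor branches of the root occur. The smallness of the row sums comes from an exact formula: the sum
  of the residues of \<open>z^n\<close> over the product of the \<open>(z - a_l)^(m_l)\<close> is a
  confluent divided difference, that is, a complete homogeneous symmetric polynomial of degree
  \<open>n - M\<close> in the nodes, where \<open>M + 1\<close> is the total multiplicity (here
  \<open>M = 3k\<close>). It vanishes for \<open>n < M\<close>. The exponent \<open>k + 1/2\<close>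
  makes every Taylor coefficient that enters a residue, of index at most \<open>k\<close>, a
  rational multiple of one square root. Origin of the exponent: with
  \<open>Q = max a1 (a2 - a1)\<close>, the integer coefficients grow about like
  \<open>(8 Q a2 N / a1)^k\<close>; as \<open>4 * 2.500788 = 8 * 1.250394\<close>, the factor
  \<open>1.250394^k\<close> remains to absorb polynomial factors. The forms decay about like
  \<open>(64 a1 a2 (a2 - a1)^2 / (3 N^2))^k\<close>, and \<open>64/3 < 1/0.04216\<close>. If
  \<open>P\<close> and \<open>1/L\<close> are the resulting bases, the choice of \<open>L^k\<close>
  near \<open>2q\<close> makes \<open>P^k\<close> of order \<open>q^(ln P / ln L)\<close>, which
  gives \<open>lam - 1\<close>.\<close>

definition expand_at :: "real \<Rightarrow> real poly \<Rightarrow> real fls" where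
  "expand_at a p = fps_to_fls (fps_of_poly (pcompose p [:a, 1:]))"

lemma expand_at_add: "expand_at a (p + q) = expand_at a p + expand_at a q"
  by (simp add: expand_at_def pcompose_add fps_of_poly_add)

lemma expand_at_diff: "expand_at a (p - q) = expand_at a p - expand_at a q"
  by (simp add: expand_at_def pcompose_diff fps_of_poly_diff)

lemma expand_at_mult: "expand_at a (p * q) = expand_at a p * expand_at a q"
  by (simp add: expand_at_def pcompose_mult fps_of_poly_mult fls_times_fps_to_fls)

lemma expand_at_1 [simp]: "expand_at a 1 = 1"
  by (simp add: expand_at_def pcompose_1)

lemma expand_at_0 [simp]: "expand_at a 0 = 0"
  by (simp add: expand_at_def)

lemma expand_at_power: "expand_at a (p ^ n) = expand_at a p ^ n"
  by (induction n) (simp_all add: expand_at_mult)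

lemma expand_at_sum: "expand_at a (sum f S) = (\<Sum>s\<in>S. expand_at a (f s))"
  by (induction S rule: infinite_finite_induct) (simp_all add: expand_at_add)

lemma expand_at_prod: "expand_at a (prod f S) = (\<Prod>s\<in>S. expand_at a (f s))"
  by (induction S rule: infinite_finite_induct) (simp_all add: expand_at_mult)

lemma expand_at_smult: "expand_at a (smult c p) = fls_const c * expand_at a p"
  by (simp add: expand_at_def pcompose_smult fps_of_poly_smult fls_times_fps_to_fls)

lemma expand_at_pderiv: "expand_at a (pderiv p) = fls_deriv (expand_at a p)"
proof -
  have "pderiv (pcompose p [:a, 1:]) = pcompose (pderiv p) [:a, 1:]"
    by (simp add: pderiv_pcompose pderiv_pCons)
  then show ?thesis
    by (simp add: expand_at_def fls_deriv_fps_to_fls fps_of_poly_pderiv [symmetric])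
qed

lemma expand_at_linear: "expand_at a [:b, c:] = fps_to_fls (fps_const (b + a * c) + fps_const c * fps_X)"
proof -
  have "pcompose [:b, c:] [:a, 1:] = [:b + a * c, c:]" by (simp add: pcompose_pCons algebra_simps)
  then show ?thesis
    unfolding expand_at_def by (simp add: fps_of_poly_pCons add.commute mult.commute)
qed

lemma expand_at_eq_0_iff: "expand_at a p = 0 \<longleftrightarrow> p = 0"
proof -
  have "fps_of_poly (pcompose p [:a, 1:]) = 0 \<longleftrightarrow> pcompose p [:a, 1:] = 0"
    using fps_of_poly_eq_iff[of _ 0] by simp
  then show ?thesis unfolding expand_at_def by (simp add: pcompose_eq_0_iff)
qed

definition root_poly :: "('n::finite \<Rightarrow> real) \<Rightarrow> ('n \<Rightarrow> nat) \<Rightarrow> real poly" where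
  "root_poly a m = (\<Prod>l\<in>UNIV. [:- a l, 1:] ^ m l)"

text \<open>The factors at the other nodes have nonzero constant term at \<open>a j\<close> when the
  nodes are distinct, so their inverses stay in the ring of power series and only the pole at
  \<open>a j\<close> itself needs Laurent series.\<close>

definition cofactor_fps :: "('n::finite \<Rightarrow> real) \<Rightarrow> ('n \<Rightarrow> nat) \<Rightarrow> 'n \<Rightarrow> real fps" where
  "cofactor_fps a m j = (\<Prod>l\<in>UNIV - {j}. inverse (fps_const (a j - a l) + fps_X) ^ m l)"

lemma quotient_root_poly:
  assumes "inj a"
  shows "fps_to_fls G / expand_at (a j) (root_poly a m)
           = fps_to_fls (G * cofactor_fps a m j) / fls_X ^ m j"
proof -
  define g where "g l = fps_const (a j - a l) + fps_X" for l
  have g_inv: "g l * inverse (g l) = 1" if "l \<noteq> j" for l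
  proof -
    have "g l $ 0 \<noteq> 0" using that assms by (auto simp: g_def inj_eq)
    then show ?thesis by (rule inverse_mult_eq_1')
  qed
  have "expand_at (a j) (root_poly a m) = (\<Prod>l\<in>UNIV. fps_to_fls (g l) ^ m l)"
    by (simp add: root_poly_def expand_at_prod expand_at_power expand_at_linear g_def)
  also have "\<dots> = fps_to_fls (g j) ^ m j * (\<Prod>l\<in>UNIV - {j}. fps_to_fls (g l) ^ m l)"
    by (simp add: prod.remove)
  finally have eq: "expand_at (a j) (root_poly a m)
      = fls_X ^ m j * (\<Prod>l\<in>UNIV - {j}. fps_to_fls (g l) ^ m l)"
    by (simp add: g_def)
  have prod_inv: "(\<Prod>l\<in>S. fps_to_fls (g l) ^ m l) * fps_to_fls (\<Prod>l\<in>S. inverse (g l) ^ m l) = 1"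
    if "finite S" "S \<subseteq> UNIV - {j}" for S
    using that
  proof (induction S rule: finite_induct)
    case (insert l S)
    have "fps_to_fls (g l) ^ m l * fps_to_fls (inverse (g l) ^ m l) = fps_to_fls ((g l * inverse (g l)) ^ m l)"
      by (simp add: fps_to_fls_power fls_times_fps_to_fls power_mult_distrib)
    also have "\<dots> = 1" using g_inv insert.prems by simp
    finally have one: "fps_to_fls (g l) ^ m l * fps_to_fls (inverse (g l) ^ m l) = 1" .
    show ?case
      using insert one by (simp add: fls_times_fps_to_fls algebra_simps)
  qed simp
  have "U / (V * P) = U * Q / V" if "P * Q = 1" for U V P Q :: "real fls"
  proof -
    have "Q = inverse P" using that by (simp add: inverse_unique)
    then show ?thesis by (simp add: divide_inverse mult_ac)
  qed
  from this[OF prod_inv[OF finite order_refl]] show ?thesis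
    by (simp add: eq cofactor_fps_def g_def fls_times_fps_to_fls)
qed

text \<open>The form as a sum with at most one nonzero term covers \<open>n = 0\<close>, where there
  is no pole and the sum is empty; the truncated index \<open>n - 1\<close> would be wrong
  there.\<close>

lemma residue_fps_over_power:
  fixes G :: "real fps"
  shows "fls_residue (fps_to_fls G / fls_X ^ n) = (\<Sum>h<n. if Suc h = n then G $ h else 0)"
proof -
  have *: "fps_to_fls G / fls_X ^ n = fls_shift (int n) (fps_to_fls G)"
    by (rule nonzero_divide_eq_eq[THEN iffD2]) (simp_all add: fls_X_power_times_conv_shift)
  show ?thesis
  proof (cases n)
    case (Suc n')
    have "(\<Sum>h<n. if Suc h = n then G $ h else 0) = G $ n'" by (simp add: Suc)
    moreover have "fls_residue (fps_to_fls G / fls_X ^ n) = G $ n'"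
      unfolding * by (simp add: Suc)
    ultimately show ?thesis by simp
  qed simp
qed

lemma residue_quotient_root_poly:
  assumes "inj a"
  shows "fls_residue (fps_to_fls G / expand_at (a j) (root_poly a m))
           = (\<Sum>h<m j. G $ h * cofactor_fps a m j $ (m j - 1 - h))"
proof (cases "m j")
  case 0
  then show ?thesis
    unfolding quotient_root_poly[OF assms] residue_fps_over_power by simp
next
  case (Suc n)
  have "fls_residue (fps_to_fls G / expand_at (a j) (root_poly a m)) = (G * cofactor_fps a m j) $ n"
    unfolding quotient_root_poly[OF assms] residue_fps_over_power by (simp add: Suc)
  also have "\<dots> = (\<Sum>h=0..n. G $ h * cofactor_fps a m j $ (n - h))" by (simp add: fps_mult_nth)
  finally show ?thesis
    by (simp add: Suc lessThan_Suc_atMost atMost_atLeast0)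
qed

section \<open>Sums of residues as confluent divided differences\<close>

definition res_sum :: "('n::finite \<Rightarrow> real) \<Rightarrow> ('n \<Rightarrow> nat) \<Rightarrow> real poly \<Rightarrow> real" where
  "res_sum a m p = (\<Sum>j\<in>UNIV. fls_residue (expand_at (a j) p / expand_at (a j) (root_poly a m)))"

lemma res_sum_add: "res_sum a m (p + q) = res_sum a m p + res_sum a m q"
  by (simp add: res_sum_def expand_at_add add_divide_distrib sum.distrib)

lemma res_sum_diff: "res_sum a m (p - q) = res_sum a m p - res_sum a m q"
  by (simp add: res_sum_def expand_at_diff diff_divide_distrib sum_subtractf)

lemma res_sum_smult: "res_sum a m (smult c p) = c * res_sum a m p"
  by (simp add: res_sum_def expand_at_smult sum_distrib_left flip: times_divide_eq_right)

lemma root_poly_remove: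
  assumes "m l > 0"
  shows "root_poly a m = [:- a l, 1:] * root_poly a (m(l := m l - 1))"
proof -
  have "(\<Prod>i\<in>UNIV - {l}. [:- a i, 1:] ^ (m(l := m l - 1)) i) = (\<Prod>i\<in>UNIV - {l}. [:- a i, 1:] ^ m i)"
    by (intro prod.cong) auto
  moreover have "[:- a l, 1:] ^ m l = [:- a l, 1:] * [:- a l, 1:] ^ (m l - 1)"
    using assms by (metis power_eq_if less_irrefl)
  ultimately show ?thesis
    unfolding root_poly_def
    by (simp only: prod.remove[OF finite UNIV_I[of l]] fun_upd_same mult.assoc)
qed

text \<open>A linear factor of the numerator cancels against the denominator. This is the recursion
  behind all evaluations of \<open>res_sum\<close>: it lowers the total multiplicity by one.\<close>

lemma res_sum_cancel:
  assumes "m l > 0"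
  shows "res_sum a m ([:- a l, 1:] * p) = res_sum a (m(l := m l - 1)) p"
proof -
  have "expand_at b [:- a l, 1:] \<noteq> 0" for b by (simp add: expand_at_eq_0_iff)
  then show ?thesis
    unfolding res_sum_def root_poly_remove[of m l, OF assms] expand_at_mult by simp
qed

lemma res_sum_0_mult:
  assumes "inj a" "\<And>l. m l = 0"
  shows "res_sum a m p = 0"
  using residue_quotient_root_poly[OF assms(1)] assms(2)
  by (simp add: res_sum_def expand_at_def)

lemma residue_one_quotient:
  assumes "inj a"
  shows "fls_residue (expand_at (a j) 1 / expand_at (a j) (root_poly a m))
           = (if m j = 0 then 0 else cofactor_fps a m j $ (m j - 1))"
proof -
  have "fls_residue (fps_to_fls 1 / expand_at (a j) (root_poly a m))
          = (\<Sum>h<m j. if h = 0 then cofactor_fps a m j $ (m j - 1) else 0)"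
    unfolding residue_quotient_root_poly[OF assms]
    by (intro sum.cong) auto
  then show ?thesis by (simp add: sum.delta')
qed

lemma sum_fun_upd_decrease:
  fixes m :: "'n::finite \<Rightarrow> nat"
  assumes "m l > 0"
  shows "sum m UNIV = Suc (sum (m(l := m l - 1)) UNIV)"
proof -
  have "sum m UNIV = m l + sum m (UNIV - {l})" by (simp add: sum.remove)
  moreover have "sum (m(l := m l - 1)) UNIV = (m l - 1) + sum m (UNIV - {l})"
    by (subst sum.remove[where x = l]) (auto intro!: sum.cong)
  ultimately show ?thesis using assms by simp
qed

text \<open>The case \<open>n = 0\<close> of the formula for monomials. Analytically,
  \<open>1/root_poly\<close> decays at infinity like \<open>z^-(M+1)\<close>, so its residues sum to
  0 unless \<open>M = 0\<close>; here partial fractions replace the point at infinity.\<close>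

lemma res_sum_1:
  assumes "inj a" "sum m UNIV = Suc M"
  shows "res_sum a m 1 = (if M = 0 then 1 else 0)"
  using assms(2)
proof (induction M arbitrary: m)
  case 0
  then obtain l where l: "m l = 1" "\<And>j. j \<noteq> l \<Longrightarrow> m j = 0"
    using sum_eq_1_iff[of UNIV m] by auto
  have "res_sum a m 1 = (\<Sum>j\<in>UNIV. if j = l then cofactor_fps a m l $ 0 else 0)"
    unfolding res_sum_def residue_one_quotient[OF assms(1)] using l by (intro sum.cong) auto
  also have "cofactor_fps a m l = 1"
    unfolding cofactor_fps_def using l(2) by (intro prod.neutral) auto
  finally show ?case by simp
next
  case (Suc M)
  obtain l where l: "m l > 0"
    using Suc.prems by (metis sum.neutral gr0I nat.distinct(1))
  have dec: "res_sum a (m(i := m i - 1)) 1 = (if M = 0 then 1 else 0)" if "m i > 0" for i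
    using Suc.IH[of "m(i := m i - 1)"] sum_fun_upd_decrease[of m i, OF that] Suc.prems
    by (simp del: fun_upd_apply)
  show ?case
  proof (cases "\<exists>l'. l' \<noteq> l \<and> m l' > 0")
    case True
    then obtain l' where l': "l' \<noteq> l" "m l' > 0" by blast
    \<comment> \<open>Both products on the right cancel to sums of the same smaller total
      multiplicity, to which the induction hypothesis assigns equal values. Their difference is 0,
      while \<open>a l - a l'\<close> is not.\<close>
    have "smult (a l - a l') 1 = [:- a l', 1:] * 1 - [:- a l, 1:] * (1 :: real poly)"
      by (simp add: one_pCons)
    then have "(a l - a l') * res_sum a m 1 = 0"
      using res_sum_cancel[of m l a 1, OF l] res_sum_cancel[of m l' a 1, OF l'(2)] dec[OF l] dec[OF l'(2)]
      by (simp only: res_sum_smult [symmetric] res_sum_diff)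
    then show ?thesis using assms(1) l' by (auto simp: inj_eq)
  next
    case False
    then have z: "\<And>j. j \<noteq> l \<Longrightarrow> m j = 0" by auto
    have "sum m UNIV = m l" using z by (subst sum.remove[where x = l]) auto
    then have ml: "m l = Suc (Suc M)" using Suc.prems by simp
    have "res_sum a m 1 = (\<Sum>j\<in>UNIV. if j = l then cofactor_fps a m l $ Suc M else 0)"
      unfolding res_sum_def residue_one_quotient[OF assms(1)] using z ml by (intro sum.cong) auto
    also have "cofactor_fps a m l = 1"
      unfolding cofactor_fps_def using z by (intro prod.neutral) auto
    finally show ?thesis by simp
  qed
qed

text \<open>The sum of residues is a complete homogeneous symmetric polynomial in the nodes; the bound is
  its number of monomials times the largest one.\<close>
lemma res_sum_monom_bound:
  assumes "inj a" "\<And>l. \<bar>a l\<bar> \<le> r" "sum m UNIV = Suc M"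
  shows "\<bar>res_sum a m (monom 1 n)\<bar> \<le> real (n choose M) * r ^ (n - M)"
  using assms(3)
proof (induction n arbitrary: m M)
  case 0
  then show ?case using res_sum_1[OF assms(1)] by (auto simp: monom_0 one_pCons [symmetric])
next
  case (Suc n)
  have r: "r \<ge> 0" using assms(2) by (meson abs_ge_zero order_trans)
  obtain l where l: "m l > 0"
    using Suc.prems by (metis sum.neutral gr0I nat.distinct(1))
  define m' where "m' = m(l := m l - 1)"
  have sum': "sum m' UNIV = M" using sum_fun_upd_decrease[of m l, OF l] Suc.prems by (simp add: m'_def)
  \<comment> \<open>Splitting \<open>z = (z - a l) + a l\<close> gives the Pascal recursion that the
    bound has to satisfy.\<close>
  have "monom 1 (Suc n) = [:- a l, 1:] * monom 1 n + smult (a l) (monom 1 n)"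
    by (simp add: monom_Suc)
  then have eq: "res_sum a m (monom 1 (Suc n)) = res_sum a m' (monom 1 n) + a l * res_sum a m (monom 1 n)"
    using res_sum_cancel[of m l a "monom 1 n", OF l] by (simp only: res_sum_add res_sum_smult m'_def)
  have "\<bar>a l * res_sum a m (monom 1 n)\<bar> \<le> r * (real (n choose M) * r ^ (n - M))"
    unfolding abs_mult using Suc assms(2) r by (intro mult_mono) auto
  then have 2: "\<bar>res_sum a m (monom 1 (Suc n))\<bar> \<le> \<bar>res_sum a m' (monom 1 n)\<bar> + real (n choose M) * (r * r ^ (n - M))"
    unfolding eq using abs_triangle_ineq[of "res_sum a m' (monom 1 n)" "a l * res_sum a m (monom 1 n)"]
    by (simp add: mult_ac)
  show ?case
  proof (cases M)
    case 0
    then have "\<And>i. m' i = 0" using sum' by simp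
    then have "res_sum a m' (monom 1 n) = 0" by (rule res_sum_0_mult[OF assms(1)])
    then show ?thesis using 2 0 by simp
  next
    case (Suc M')
    have 1: "\<bar>res_sum a m' (monom 1 n)\<bar> \<le> real (n choose M') * r ^ (n - M')"
      using Suc.IH[of m' M'] sum' Suc by simp
    show ?thesis
    \<comment> \<open>For \<open>n < M\<close> the exponents are cut off at 0 and the powers of
      \<open>r\<close> do not match, but then \<open>n choose M\<close> vanishes.\<close>
    proof (cases "n < M")
      case True
      then have "n < Suc M'" "n - M' = 0" using Suc by simp_all
      then show ?thesis using 1 2 Suc by (simp add: binomial_eq_0)
    next
      case False
      then have "r * r ^ (n - M) = r ^ (n - M')" using Suc by (simp add: Suc_diff_Suc flip: power_Suc)
      then show ?thesis using 1 2 Suc by (simp add: algebra_simps)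
    qed
  qed
qed

section \<open>Residues of binomial functions\<close>

text \<open>The Taylor series of \<open>(1 + z x) powr \<kappa>\<close> at \<open>z = a\<close>,
  given by its coefficients.\<close>

definition binom_fps :: "real \<Rightarrow> real \<Rightarrow> real \<Rightarrow> real fps" where
  "binom_fps \<kappa> x a = Abs_fps (\<lambda>h. (\<kappa> gchoose h) * x ^ h * (1 + a * x) powr (\<kappa> - real h))"

lemma binom_fps_nth: "binom_fps \<kappa> x a $ h = (\<kappa> gchoose h) * x ^ h * (1 + a * x) powr (\<kappa> - real h)"
  by (simp add: binom_fps_def)

text \<open>The differential equation \<open>(1 + z x) F' = \<kappa> x F\<close>, which is all that
  the Hermite reduction has to know about \<open>F\<close>.\<close>

lemma deriv_binom_fps:
  assumes "1 + a * x > 0"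
  shows "fls_deriv (fps_to_fls (binom_fps \<kappa> x a)) * expand_at a [:1, x:]
           = fls_const (\<kappa> * x) * fps_to_fls (binom_fps \<kappa> x a)"
proof -
  let ?F = "binom_fps \<kappa> x a" and ?u = "1 + a * x"
  have "fps_deriv ?F * (fps_const ?u + fps_const x * fps_X) = fps_const (\<kappa> * x) * ?F"
  proof (rule fps_ext)
    fix n
    have absorb: "(1 + real n) * (\<kappa> gchoose Suc n) = (\<kappa> - real n) * (\<kappa> gchoose n)"
      using gbinomial_absorption[of n \<kappa>] gbinomial_absorb_comp[of \<kappa> n] by (simp add: algebra_simps)
    have u: "?u * ?u powr (\<kappa> - (1 + real n)) = ?u powr (\<kappa> - real n)"
      using assms powr_add[of ?u 1 "\<kappa> - (1 + real n)"] by simp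
    have "(fps_deriv ?F * (fps_const ?u + fps_const x * fps_X)) $ n
        = (1 + real n) * ?F $ Suc n * ?u + x * (real n * ?F $ n)"
    proof -
      have "fps_deriv ?F * (fps_const ?u + fps_const x * fps_X)
              = fps_const ?u * fps_deriv ?F + fps_const x * (fps_X * fps_deriv ?F)"
        by (simp only: algebra_simps)
      then show ?thesis by (cases n) simp_all
    qed
    also have "(1 + real n) * ?F $ Suc n * ?u = (\<kappa> - real n) * x * ?F $ n"
      using absorb u by (simp add: binom_fps_nth) algebra
    finally show "(fps_deriv ?F * (fps_const ?u + fps_const x * fps_X)) $ n = (fps_const (\<kappa> * x) * ?F) $ n"
      by (simp add: algebra_simps)
  qed
  then show ?thesis
    by (simp only: expand_at_linear fls_deriv_fps_to_fls mult.right_neutral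
          fls_times_fps_to_fls [symmetric] fps_const_to_fls [symmetric])
qed

lemma gbinomial_mult_binomial:
  "(\<kappa> gchoose (n + M)) * real ((n + M) choose M) = (\<kappa> gchoose M) * ((\<kappa> - real M) gchoose n)"
  for \<kappa> :: real
  using gbinomial_trinomial_revision[of M "n + M" \<kappa>] by (simp add: binomial_gbinomial)

text \<open>Expanding the binomial series at 0 and moving each monomial to \<open>a\<close> gives
  the Taylor coefficients at \<open>a\<close>: trinomial revision turns the sum into the binomial
  series of exponent \<open>\<kappa> - h\<close> at \<open>a * x\<close>.\<close>

lemma binom_fps_sums:
  assumes "\<bar>a * x\<bar> < 1"
  shows "(\<lambda>n. (\<kappa> gchoose n) * x ^ n * coeff (pcompose (monom 1 n) [:a, 1:]) h) sums (binom_fps \<kappa> x a $ h)"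
proof -
  define f where "f n = (\<kappa> gchoose n) * x ^ n * coeff (pcompose (monom 1 n) [:a, 1:]) h" for n
  have pow: "pcompose (monom 1 n) [:a, 1:] = [:a, 1:] ^ n" for n
    by (induction n) (simp_all add: monom_Suc pcompose_pCons monom_0)
  have coeff: "coeff (pcompose (monom 1 n) [:a, 1:]) h = real (n choose h) * a ^ (n - h)" for n
  proof (cases "h \<le> n")
    case True
    then show ?thesis unfolding pow by (simp add: coeff_linear_poly_power)
  next
    case False
    have "degree ([:a, 1:] ^ n) \<le> n" using degree_power_le[of "[:a, 1:]" n] by simp
    then show ?thesis unfolding pow using False by (simp add: coeff_eq_0 binomial_eq_0)
  qed
  have "(\<lambda>n. (\<kappa> gchoose h) * x ^ h * (((\<kappa> - real h) gchoose n) * (a * x) ^ n)) sums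
          ((\<kappa> gchoose h) * x ^ h * (1 + a * x) powr (\<kappa> - real h))"
    by (intro sums_mult gen_binomial_real assms)
  moreover have "(\<kappa> gchoose h) * x ^ h * (((\<kappa> - real h) gchoose n) * (a * x) ^ n) = f (n + h)" for n
    using gbinomial_mult_binomial[of \<kappa> n h]
    by (simp add: f_def coeff power_add power_mult_distrib mult_ac)
  ultimately have "(\<lambda>n. f (n + h)) sums (binom_fps \<kappa> x a $ h)"
    by (simp add: binom_fps_nth)
  moreover have "f n = 0" if "n < h" for n using that by (simp add: f_def coeff binomial_eq_0)
  ultimately have "f sums (binom_fps \<kappa> x a $ h)" by (subst (asm) sums_zero_iff_shift) auto
  then show ?thesis unfolding f_def .
qed

definition binom_res_sum :: "('n::finite \<Rightarrow> real) \<Rightarrow> ('n \<Rightarrow> nat) \<Rightarrow> real \<Rightarrow> real \<Rightarrow> real" where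
  "binom_res_sum a m \<kappa> x =
     (\<Sum>j\<in>UNIV. fls_residue (fps_to_fls (binom_fps \<kappa> x (a j)) / expand_at (a j) (root_poly a m)))"

text \<open>A residue is a finite linear combination of Taylor coefficients, so the expansion in
  \<open>x\<close> may be carried out term by term.\<close>

lemma binom_res_sum_sums:
  assumes "inj a" "\<And>l. \<bar>a l * x\<bar> < 1"
  shows "(\<lambda>n. (\<kappa> gchoose n) * x ^ n * res_sum a m (monom 1 n)) sums binom_res_sum a m \<kappa> x"
proof -
  have "(\<lambda>n. \<Sum>j\<in>UNIV. \<Sum>h<m j. (\<kappa> gchoose n) * x ^ n * coeff (pcompose (monom 1 n) [:a j, 1:]) h
              * cofactor_fps a m j $ (m j - 1 - h)) sums binom_res_sum a m \<kappa> x"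
    unfolding binom_res_sum_def residue_quotient_root_poly[OF assms(1)]
    by (intro sums_sum sums_mult2 binom_fps_sums assms)
  then show ?thesis
    unfolding res_sum_def expand_at_def[of _ "monom 1 _"] residue_quotient_root_poly[OF assms(1)]
    by (simp add: sum_distrib_left mult_ac)
qed

lemma pochhammer_nonneg_of_nonneg:
  fixes c :: real
  assumes "c \<ge> 0"
  shows "pochhammer c n \<ge> 0"
  using assms by (induction n) (auto simp: pochhammer_rec' intro!: mult_nonneg_nonneg)

text \<open>All factors \<open>c - i\<close> are nonpositive, so \<open>c gchoose n\<close> has the
  sign of \<open>(-1) ^ n\<close>. Hence the series of absolute values is again a binomial series,
  taken at \<open>-y\<close>.\<close>

lemma abs_gbinomial_nonpos:
  fixes c y :: real
  assumes "c \<le> 0"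
  shows "\<bar>c gchoose n\<bar> * y ^ n = (c gchoose n) * (- y) ^ n"
proof -
  have "pochhammer (- c) n \<ge> 0" using assms by (intro pochhammer_nonneg_of_nonneg) simp
  then show ?thesis
    by (cases "even n") (simp_all add: gbinomial_pochhammer abs_mult)
qed

text \<open>Terms with \<open>n < M\<close> vanish. The others are dominated by a series that
  trinomial revision turns into the binomial series of exponent \<open>\<kappa> - M\<close> at
  \<open>- r * x\<close>; the condition \<open>\<kappa> \<le> M\<close> gives this series constant
  sign, so the majorant has a closed sum.\<close>

lemma binom_res_sum_bound:
  assumes "inj a" "\<And>l. \<bar>a l\<bar> \<le> r" "0 \<le> x" "r * x < 1" "sum m UNIV = Suc M" "\<kappa> \<le> real M"
  shows "\<bar>binom_res_sum a m \<kappa> x\<bar> \<le> \<bar>\<kappa> gchoose M\<bar> * x ^ M * (1 - r * x) powr (\<kappa> - real M)"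
proof -
  have r: "r \<ge> 0" using assms(2) by (meson abs_ge_zero order_trans)
  define f where "f n = \<bar>\<kappa> gchoose n\<bar> * x ^ n * (real (n choose M) * r ^ (n - M))" for n
  define g where "g n = (\<kappa> gchoose n) * x ^ n * res_sum a m (monom 1 n)" for n
  have small: "\<bar>a l * x\<bar> < 1" for l
  proof -
    have "\<bar>a l * x\<bar> \<le> r * x" using assms(2,3) by (simp add: abs_mult mult_right_mono)
    then show ?thesis using assms(4) by simp
  qed
  have g: "g sums binom_res_sum a m \<kappa> x"
    unfolding g_def using assms(1) small by (rule binom_res_sum_sums)
  have le: "\<bar>g n\<bar> \<le> f n" for n
  proof -
    have "\<bar>g n\<bar> = \<bar>\<kappa> gchoose n\<bar> * x ^ n * \<bar>res_sum a m (monom 1 n)\<bar>"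
      using assms(3) by (simp add: g_def abs_mult)
    also have "\<dots> \<le> f n" unfolding f_def
      using res_sum_monom_bound[OF assms(1,2,5)] assms(3) by (intro mult_left_mono) auto
    finally show ?thesis .
  qed
  have "(\<lambda>n. \<bar>\<kappa> gchoose M\<bar> * x ^ M * (((\<kappa> - real M) gchoose n) * (- (r * x)) ^ n)) sums
          (\<bar>\<kappa> gchoose M\<bar> * x ^ M * (1 + - (r * x)) powr (\<kappa> - real M))"
    using r assms(3,4) by (intro sums_mult gen_binomial_real) auto
  moreover have "\<bar>\<kappa> gchoose M\<bar> * x ^ M * (((\<kappa> - real M) gchoose n) * (- (r * x)) ^ n) = f (n + M)" for n
  proof -
    have "\<bar>\<kappa> gchoose (n + M)\<bar> * real ((n + M) choose M) = \<bar>\<kappa> gchoose M\<bar> * \<bar>(\<kappa> - real M) gchoose n\<bar>"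
      using arg_cong[OF gbinomial_mult_binomial[of \<kappa> n M], of abs] by (simp add: abs_mult)
    then show ?thesis
      using abs_gbinomial_nonpos[of "\<kappa> - real M" n "r * x"] assms(6)
      by (simp add: f_def power_add power_mult_distrib mult_ac)
  qed
  ultimately have "(\<lambda>n. f (n + M)) sums (\<bar>\<kappa> gchoose M\<bar> * x ^ M * (1 - r * x) powr (\<kappa> - real M))" by simp
  moreover have "f n = 0" if "n < M" for n using that by (simp add: f_def binomial_eq_0)
  ultimately have f: "f sums (\<bar>\<kappa> gchoose M\<bar> * x ^ M * (1 - r * x) powr (\<kappa> - real M))"
    by (subst (asm) sums_zero_iff_shift) auto
  have "binom_res_sum a m \<kappa> x \<le> \<bar>\<kappa> gchoose M\<bar> * x ^ M * (1 - r * x) powr (\<kappa> - real M)"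
  proof (rule sums_le[OF _ g f])
    show "g n \<le> f n" for n using le[of n] by (simp add: abs_le_iff)
  qed
  moreover have "- (\<bar>\<kappa> gchoose M\<bar> * x ^ M * (1 - r * x) powr (\<kappa> - real M)) \<le> binom_res_sum a m \<kappa> x"
  proof (rule sums_le[OF _ sums_minus[OF f] g])
    show "- f n \<le> g n" for n using le[of n] by (simp add: abs_le_iff)
  qed
  ultimately show ?thesis by (simp add: abs_le_iff)
qed

text \<open>Each factor \<open>\<bar>k + 1/2 - i\<bar>\<close> is rounded up to an integer. The
  factors with \<open>i \<le> k\<close> give at most \<open>(k + 1)!\<close>, the rest at most
  \<open>(2k - 1)!\<close>, and since \<open>k + 1 \<le> 2k\<close> the quotient by
  \<open>(3k)!\<close> is at most the inverse of \<open>3k choose k\<close>.\<close>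

lemma abs_gbinomial_half_bound:
  assumes "k > 0"
  shows "\<bar>(real k + 1/2) gchoose (3 * k)\<bar> \<le> 1 / 3 ^ k"
proof -
  let ?f = "\<lambda>i. \<bar>real k + 1/2 - real i\<bar>"
  have "\<bar>(real k + 1/2) gchoose (3 * k)\<bar> = (\<Prod>i=0..<3*k. ?f i) / fact (3 * k)"
    by (simp add: gbinomial_prod_rev abs_prod)
  also have "(\<Prod>i=0..<3*k. ?f i) = (\<Prod>i=0..<k+1. ?f i) * (\<Prod>i=k+1..<3*k. ?f i)"
    using assms by (intro prod.atLeastLessThan_concat [symmetric]) auto
  also have "\<dots> \<le> fact (k + 1) * fact (2 * k - 1)"
  proof (intro mult_mono prod_nonneg)
    have "(\<Prod>i=0..<k+1. ?f i) \<le> (\<Prod>i=0..<k+1. real (k + 1 - i))"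
      by (intro prod_mono) (auto simp: of_nat_diff abs_if)
    then show "(\<Prod>i=0..<k+1. ?f i) \<le> fact (k + 1)"
      by (simp only: fact_prod_rev of_nat_prod of_nat_id)
    have "(\<Prod>i=k+1..<3*k. ?f i) = (\<Prod>i=0+(k+1)..<(2*k-1)+(k+1). ?f i)"
      using assms by (intro prod.cong) auto
    also have "\<dots> = (\<Prod>i=0..<2*k-1. ?f (i + (k+1)))"
      by (rule prod.shift_bounds_nat_ivl)
    also have "\<dots> \<le> (\<Prod>i=0..<2*k-1. real (Suc i))"
      by (intro prod_mono) auto
    also have "\<dots> = fact (2 * k - 1)" by (simp add: fact_prod_Suc)
    finally show "(\<Prod>i=k+1..<3*k. ?f i) \<le> fact (2 * k - 1)" .
  qed auto
  finally have 1: "\<bar>(real k + 1/2) gchoose (3 * k)\<bar> \<le> fact (k + 1) * fact (2 * k - 1) / fact (3 * k)"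
    by (simp add: divide_right_mono)
  have "fact (k + 1) * fact (2 * k - 1) \<le> (fact k * fact (2 * k) :: real)"
  proof -
    obtain j where j: "2 * k = Suc j" using assms by (cases "2 * k") auto
    have f: "fact (2 * k) = real (2 * k) * fact (2 * k - 1)" unfolding j by simp
    have "fact (k + 1) * fact (2 * k - 1) = real (k + 1) * (fact k * fact (2 * k - 1))"
      by (simp add: algebra_simps)
    also have "\<dots> \<le> real (2 * k) * (fact k * fact (2 * k - 1))"
      using assms by (intro mult_right_mono) auto
    finally show ?thesis unfolding f by (simp add: mult_ac)
  qed
  then have 2: "fact (k + 1) * fact (2 * k - 1) / fact (3 * k) \<le> fact k * fact (2 * k) / (fact (3 * k) :: real)"
    by (intro divide_right_mono) auto
  have "real (3 * k choose k) = fact (3 * k) / (fact k * fact (3 * k - k))"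
    by (rule binomial_fact) simp
  moreover have "3 * k - k = 2 * k" by simp
  ultimately have 3: "fact k * fact (2 * k) / (fact (3 * k) :: real) = 1 / real (3 * k choose k)" by simp
  have "(3::real) ^ k \<le> real (3 * k choose k)"
    using binomial_ge_n_over_k_pow_k[of k "3 * k", where ?'a = real] assms by simp
  then have "1 / real (3 * k choose k) \<le> 1 / 3 ^ k" by (intro divide_left_mono) auto
  with 1 2 3 show ?thesis by linarith
qed

section \<open>Hermite reduction and nonvanishing\<close>

definition node_poly :: "('n::finite \<Rightarrow> real) \<Rightarrow> real poly" where
  "node_poly a = (\<Prod>l\<in>UNIV. [:- a l, 1:])"

lemma node_poly_eq_root_poly: "node_poly a = root_poly a (\<lambda>_. 1)"
  by (simp add: node_poly_def root_poly_def)

lemma node_poly_nonzero: "node_poly a \<noteq> 0"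
  by (simp add: node_poly_def)

definition lagrange_poly :: "('n::finite \<Rightarrow> real) \<Rightarrow> 'n \<Rightarrow> real poly" where
  "lagrange_poly a i = (\<Prod>l\<in>UNIV - {i}. [:- a l, 1:])"

lemma node_poly_eq: "node_poly a = [:- a i, 1:] * lagrange_poly a i"
  by (simp only: node_poly_def lagrange_poly_def prod.remove[OF finite UNIV_I[of i]])

lemma degree_node_poly: "degree (node_poly (a :: 'n::finite \<Rightarrow> real)) = CARD('n)"
  by (simp add: node_poly_def degree_prod_eq_sum_degree)

lemma degree_lagrange_poly: "degree (lagrange_poly (a :: 'n::finite \<Rightarrow> real) i) < CARD('n)"
proof -
  have "degree (lagrange_poly a i) = CARD('n) - 1"
    by (simp add: lagrange_poly_def degree_prod_eq_sum_degree card_Diff_singleton)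
  then show ?thesis by simp
qed

lemma lead_coeff_node_poly: "coeff (node_poly (a :: 'n::finite \<Rightarrow> real)) (CARD('n)) = 1"
proof -
  have "lead_coeff (node_poly a) = 1" by (simp add: node_poly_def lead_coeff_prod)
  then show ?thesis by (simp only: degree_node_poly)
qed

lemma poly_node_poly [simp]: "poly (node_poly a) (a j) = 0"
  by (simp add: node_poly_eq[of a j])

lemma poly_lagrange_poly_other: "i \<noteq> j \<Longrightarrow> poly (lagrange_poly a i) (a j) = 0"
  by (auto simp: lagrange_poly_def poly_prod prod_zero_iff)

lemma poly_lagrange_poly_same: "inj a \<Longrightarrow> poly (lagrange_poly a i) (a i) \<noteq> 0"
  by (auto simp: lagrange_poly_def poly_prod prod_zero_iff inj_eq)

lemma poly_pderiv_node_poly: "poly (pderiv (node_poly a)) (a j) = poly (lagrange_poly a j) (a j)"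
  unfolding node_poly_eq[of a j] by (simp add: pderiv_mult pderiv_pCons del: mult_pCons_left)

lemma eq_0_if_vanishes_at_nodes:
  fixes a :: "'n::finite \<Rightarrow> real"
  assumes "inj a" "degree p < CARD('n)" "\<And>j. poly p (a j) = 0"
  shows "p = 0"
proof (rule ccontr)
  assume "p \<noteq> 0"
  have "CARD('n) = card (range a)" using assms(1) by (simp add: card_image)
  also have "\<dots> \<le> card {x. poly p x = 0}"
    using assms(3) poly_roots_finite[OF \<open>p \<noteq> 0\<close>] by (intro card_mono) auto
  also have "\<dots> \<le> degree p" using \<open>p \<noteq> 0\<close> by (rule card_poly_roots_bound)
  finally show False using assms(2) by simp
qed

lemma node_poly_dvd:
  fixes a :: "'n::finite \<Rightarrow> real"
  assumes "inj a" "\<And>j. poly p (a j) = 0"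
  shows "node_poly a dvd p"
proof -
  have "p mod node_poly a = 0"
  proof (rule eq_0_if_vanishes_at_nodes[OF assms(1)])
    have "node_poly a \<noteq> 0" by (rule node_poly_nonzero)
    then have "p mod node_poly a = 0 \<or> degree (p mod node_poly a) < degree (node_poly a)"
      by (rule degree_mod_less)
    then show "degree (p mod node_poly a) < CARD('n)" by (auto simp: degree_node_poly)
    show "poly (p mod node_poly a) (a j) = 0" for j
      unfolding minus_mult_div_eq_mod [symmetric] by (simp add: assms(2) del: minus_mult_div_eq_mod)
  qed
  then show ?thesis by (simp add: mod_eq_0_iff_dvd)
qed

lemma interpolation_exists:
  fixes a :: "'n::finite \<Rightarrow> real"
  assumes "inj a"
  shows "\<exists>w. degree w < CARD('n) \<and> (\<forall>j. poly w (a j) = v j)"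
proof -
  define w where "w = (\<Sum>i\<in>UNIV. smult (v i / poly (lagrange_poly a i) (a i)) (lagrange_poly a i))"
  have "degree w < CARD('n)"
    unfolding w_def
    by (intro degree_sum_less) (auto intro: le_less_trans[OF degree_smult_le] degree_lagrange_poly)
  moreover have "poly w (a j) = v j" for j
  proof -
    have "poly w (a j) = (\<Sum>i\<in>UNIV. if i = j then v j else 0)"
      unfolding w_def poly_sum
      using poly_lagrange_poly_same[OF assms] by (intro sum.cong) (auto simp: poly_lagrange_poly_other)
    then show ?thesis by simp
  qed
  ultimately show ?thesis by blast
qed

text \<open>The numerator of the derivative of \<open>(1 + z x)\<^bsup>\<kappa>+1\<^esup> w(z) / A(z)\<^sup>m\<close> with
  \<open>(1 + z x)\<^sup>\<kappa> / A(z)\<^bsup>m+1\<^esup>\<close> split off, where \<open>A\<close> is the node polynomial.\<close>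
definition reduction_op :: "('n::finite \<Rightarrow> real) \<Rightarrow> real \<Rightarrow> real \<Rightarrow> nat \<Rightarrow> real poly \<Rightarrow> real poly" where
  "reduction_op a \<kappa> x m w =
     (smult ((\<kappa> + 1) * x) w + [:1, x:] * pderiv w) * node_poly a
       - smult (real m) ([:1, x:] * w * pderiv (node_poly a))"

lemma reduction_op_add: "reduction_op a \<kappa> x m (v + w) = reduction_op a \<kappa> x m v + reduction_op a \<kappa> x m w"
  by (simp add: reduction_op_def algebra_simps pderiv_add smult_add_right del: mult_pCons_left mult_pCons_right)

text \<open>Replacing \<open>w / A^m\<close> by \<open>A w / A^(m+1)\<close> does not change the
  function that is differentiated, so the numerator only gains a factor \<open>A\<close>.\<close>

lemma reduction_op_node_poly_mult:
  "reduction_op a \<kappa> x (Suc m) (node_poly a * w) = node_poly a * reduction_op a \<kappa> x m w"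
proof -
  have *: "smult (1 + real m) p = p + smult (real m) p" for p :: "real poly"
    by (simp add: smult_add_left)
  show ?thesis
    by (simp add: reduction_op_def pderiv_mult algebra_simps * smult_add_right
        del: mult_pCons_left mult_pCons_right)
qed

text \<open>The series in question is a derivative, and derivatives of Laurent series have residue
  0. In the antiderivative \<open>Q\<close> below, \<open>F * Y\<close> stands for
  \<open>(1 + z x) powr (\<kappa> + 1)\<close>.\<close>

lemma residue_reduction_op:
  assumes "1 + b * x > 0"
  shows "fls_residue (fps_to_fls (binom_fps \<kappa> x b) * expand_at b (reduction_op a \<kappa> x m w)
           / expand_at b (node_poly a) ^ Suc m) = 0"
proof -
  define F where "F = fps_to_fls (binom_fps \<kappa> x b)"
  define A where "A = expand_at b (node_poly a)"
  define Y where "Y = expand_at b [:1, x:]"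
  define W where "W = expand_at b w"
  define Q where "Q = F * Y * W / A ^ m"
  have A0: "A \<noteq> 0" by (simp add: A_def expand_at_eq_0_iff node_poly_nonzero)
  have F: "fls_deriv F * Y = fls_const (\<kappa> * x) * F"
    unfolding F_def Y_def using assms by (rule deriv_binom_fps)
  have Y: "fls_deriv Y = fls_const x"
    unfolding Y_def by (simp add: expand_at_linear fls_deriv_fps_to_fls fls_times_fps_to_fls)
  have QA: "Q * A ^ m = F * Y * W" using A0 by (simp add: Q_def)
  \<comment> \<open>Multiplied by \<open>A\<close> so that \<open>m = 0\<close> fits without the
    exponent \<open>m - 1\<close>.\<close>
  have pow: "fls_deriv (A ^ m) * A = of_nat m * A ^ m * fls_deriv A"
  proof (cases m)
    case (Suc n)
    have "A ^ m = A ^ n * A" by (simp add: Suc)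
    moreover have "fls_deriv (A ^ m) = of_nat m * A ^ n * fls_deriv A"
      using fls_deriv_power[of A m] by (simp add: Suc)
    ultimately show ?thesis by (simp only: mult_ac)
  qed simp
  have "fls_deriv Q * A ^ Suc m + of_nat m * (Q * A ^ m) * fls_deriv A = fls_deriv (Q * A ^ m) * A"
    using pow by (simp add: algebra_simps)
  also have "fls_deriv (Q * A ^ m) = (fls_deriv F * Y) * W + F * fls_const x * W + F * Y * fls_deriv W"
    unfolding QA by (simp add: Y algebra_simps)
  finally have "fls_deriv Q * A ^ Suc m
      = F * ((fls_const ((\<kappa> + 1) * x) * W + Y * fls_deriv W) * A - of_nat m * (Y * W * fls_deriv A))"
    unfolding QA F by (simp add: algebra_simps flip: fls_plus_const)
  also have "\<dots> = F * expand_at b (reduction_op a \<kappa> x m w)"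
    unfolding reduction_op_def expand_at_diff expand_at_mult expand_at_add expand_at_smult expand_at_pderiv
    by (simp add: A_def Y_def W_def fls_of_nat mult_ac)
  finally have "F * expand_at b (reduction_op a \<kappa> x m w) / A ^ Suc m = fls_deriv Q"
    using A0 by (simp add: nonzero_divide_eq_eq)
  then show ?thesis unfolding F_def A_def using fls_residue_deriv by simp
qed

text \<open>Hermite reduction of the pole order from \<open>m + 1\<close> to 1. At a node the
  operator takes the value \<open>- m (1 + a_j x) w(a_j) A'(a_j)\<close> with nonzero factors for
  \<open>m > 0\<close>, so interpolation finds a \<open>v\<close> that matches \<open>c\<close> at
  all nodes. The difference is divisible by \<open>A\<close>, and the quotient again has degree
  below the number of nodes.\<close>

lemma reduction_op_decompose:
  fixes a :: "'n::finite \<Rightarrow> real"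
  assumes "inj a" "\<And>j. 1 + a j * x \<noteq> 0" "degree c < CARD('n)"
  shows "\<exists>w g. degree g < CARD('n) \<and> c = reduction_op a \<kappa> x m w + node_poly a ^ m * g"
  using assms(3)
proof (induction m arbitrary: c)
  case 0
  then show ?case by (intro exI[of _ 0] exI[of _ c]) (simp add: reduction_op_def)
next
  case (Suc m)
  let ?n = "CARD('n)" and ?A = "node_poly a"
  obtain v where v: "degree v < ?n"
    "\<And>j. poly v (a j) = - poly c (a j) / (real (Suc m) * (1 + a j * x) * poly (lagrange_poly a j) (a j))"
    using interpolation_exists[OF assms(1), of "\<lambda>j. - poly c (a j) / (real (Suc m) * (1 + a j * x) * poly (lagrange_poly a j) (a j))"] by blast
  define p where "p = c - reduction_op a \<kappa> x (Suc m) v"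
  have "poly p (a j) = 0" for j
  proof -
    have "poly v (a j) * (real (Suc m) * (1 + a j * x) * poly (lagrange_poly a j) (a j)) = - poly c (a j)"
      using v(2)[of j] assms(2)[of j] poly_lagrange_poly_same[OF assms(1), of j] by simp
    then show ?thesis
      by (simp add: p_def reduction_op_def poly_pderiv_node_poly algebra_simps del: of_nat_Suc)
  qed
  then obtain g where g: "p = ?A * g" using node_poly_dvd[OF assms(1)] by (metis dvdE)
  have n0: "?n > 0" by simp
  have deg_Y: "degree [:1, x:] \<le> 1" by simp
  have dv: "degree (pderiv v) \<le> ?n - 2" "degree (pderiv ?A) \<le> ?n - 1"
    using v(1) degree_pderiv[of v] degree_pderiv[of ?A] by (auto simp: degree_node_poly)
  have "degree p \<le> 2 * ?n - 1"
    unfolding p_def reduction_op_def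
  proof (intro degree_diff_le)
    show "degree c \<le> 2 * ?n - 1" using Suc.prems by simp
    have "degree ([:1, x:] * pderiv v) \<le> ?n - 1"
    proof (cases "pderiv v = 0")
      case False
      then have "degree v \<noteq> 0" using pderiv_eq_0_iff by blast
      then show ?thesis
        using degree_mult_le[of "[:1, x:]" "pderiv v"] v(1) deg_Y degree_pderiv[of v] by linarith
    qed simp
    then have "degree (smult ((\<kappa> + 1) * x) v + [:1, x:] * pderiv v) \<le> ?n - 1"
      using v(1) by (intro degree_add_le order_trans[OF degree_smult_le]) auto
    then show "degree ((smult ((\<kappa> + 1) * x) v + [:1, x:] * pderiv v) * ?A) \<le> 2 * ?n - 1"
      using n0 by (intro order_trans[OF degree_mult_le]) (simp add: degree_node_poly)
    have "degree ([:1, x:] * v * pderiv ?A) \<le> 1 + (?n - 1) + (?n - 1)"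
      using v(1) dv(2) deg_Y degree_mult_le[of "[:1, x:] * v" "pderiv ?A"] degree_mult_le[of "[:1, x:]" v]
      by linarith
    then show "degree (smult (real (Suc m)) ([:1, x:] * v * pderiv ?A)) \<le> 2 * ?n - 1"
      using n0 by (intro order_trans[OF degree_smult_le]) simp
  qed
  then have "degree g < ?n"
  proof (cases "g = 0")
    case False
    then have "degree p = ?n + degree g"
      unfolding g using node_poly_nonzero[of a] by (subst degree_mult_eq) (auto simp: degree_node_poly)
    then show ?thesis using \<open>degree p \<le> 2 * ?n - 1\<close> n0 by linarith
  qed simp
  from Suc.IH[OF this] obtain w g0
    where w: "degree g0 < ?n" "g = reduction_op a \<kappa> x m w + ?A ^ m * g0" by blast
  have "c = reduction_op a \<kappa> x (Suc m) v + ?A * g" using g unfolding p_def by (simp add: algebra_simps)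
  also have "\<dots> = reduction_op a \<kappa> x (Suc m) (v + ?A * w) + ?A ^ Suc m * g0"
    unfolding w(2) reduction_op_add reduction_op_node_poly_mult by (simp add: algebra_simps)
  finally show ?case using w(1) by blast
qed

lemma coeff_mult_top:
  fixes p q :: "'a::comm_semiring_0 poly"
  assumes "degree p \<le> m" "degree q \<le> n"
  shows "coeff (p * q) (m + n) = coeff p m * coeff q n"
proof (cases "degree p = m \<and> degree q = n")
  case True
  then show ?thesis using coeff_mult_degree_sum[of p q] by auto
next
  case False
  then have "coeff p m * coeff q n = 0" using assms by (auto simp: coeff_eq_0)
  moreover have "degree (p * q) < m + n" using False assms degree_mult_le[of p q] by linarith
  ultimately show ?thesis by (simp add: coeff_eq_0)
qed

text \<open>At infinity \<open>(1 + z x)^(\<kappa>+1) w / A^m\<close> has order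
  \<open>\<kappa> + 1 + degree w - m n\<close>, with \<open>n\<close> nodes. Differentiation lowers
  the order by exactly one unless it is 0, which the last hypothesis excludes; so the numerator has
  degree \<open>degree w + n\<close>.\<close>

lemma degree_reduction_op_ge:
  fixes a :: "'n::finite \<Rightarrow> real"
  assumes "x \<noteq> 0" "w \<noteq> 0" "\<kappa> + 1 + real (degree w) \<noteq> real m * real CARD('n)"
  shows "degree (reduction_op a \<kappa> x m w) \<ge> CARD('n)"
proof -
  let ?n = "CARD('n)" and ?d = "degree w" and ?A = "node_poly a"
  have n0: "?n > 0" by simp
  have 1: "coeff (smult ((\<kappa> + 1) * x) w + [:1, x:] * pderiv w) ?d = ((\<kappa> + 1) * x + x * real ?d) * lead_coeff w"
  proof (cases ?d)
    case 0
    then have "pderiv w = 0" using pderiv_eq_0_iff by blast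
    then show ?thesis using 0 by simp
  next
    case (Suc d)
    have "coeff (pderiv w) (Suc d) = 0" using Suc by (simp add: coeff_pderiv coeff_eq_0)
    then show ?thesis using Suc by (simp add: coeff_pderiv algebra_simps)
  qed
  have deg1: "degree (smult ((\<kappa> + 1) * x) w + [:1, x:] * pderiv w) \<le> ?d"
  proof (cases "pderiv w = 0")
    case False
    then have "?d \<noteq> 0" using pderiv_eq_0_iff by blast
    then have "degree ([:1, x:] * pderiv w) \<le> ?d"
      using degree_mult_le[of "[:1, x:]" "pderiv w"] degree_pderiv[of w] by (auto split: if_splits)
    then show ?thesis by (intro degree_add_le) auto
  qed simp
  have 2: "coeff ((smult ((\<kappa> + 1) * x) w + [:1, x:] * pderiv w) * ?A) (?d + ?n)
      = ((\<kappa> + 1) * x + x * real ?d) * lead_coeff w"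
    using deg1 by (subst coeff_mult_top) (simp_all only: degree_node_poly 1 lead_coeff_node_poly order_refl mult_1_right)
  have 3: "coeff (pderiv ?A) (?n - 1) = real ?n"
    using n0 lead_coeff_node_poly[of a] by (simp add: coeff_pderiv)
  have "coeff ([:1, x:] * w * pderiv ?A) (1 + ?d + (?n - 1)) = coeff ([:1, x:] * w) (1 + ?d) * coeff (pderiv ?A) (?n - 1)"
    using degree_mult_le[of "[:1, x:]" w] degree_pderiv[of ?A]
    by (intro coeff_mult_top) (auto simp: degree_node_poly split: if_splits)
  also have "coeff ([:1, x:] * w) (1 + ?d) = coeff [:1, x:] 1 * lead_coeff w"
    by (intro coeff_mult_top) auto
  finally have "coeff ([:1, x:] * w * pderiv ?A) (?d + ?n) = x * lead_coeff w * real ?n"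
    using n0 3 by (simp del: mult_pCons_left)
  with 2 have "coeff (reduction_op a \<kappa> x m w) (?d + ?n)
      = x * lead_coeff w * (\<kappa> + 1 + real ?d - real m * real ?n)"
    unfolding reduction_op_def by (simp add: algebra_simps del: mult_pCons_left)
  also have "\<dots> \<noteq> 0" using assms by simp
  finally show ?thesis by (meson le_add2 le_degree order_trans)
qed

lemma fls_residue_sum: "fls_residue (sum f S) = (\<Sum>s\<in>S. fls_residue (f s))"
  by (induction S rule: infinite_finite_induct) (simp_all add: fls_residue_add)

section \<open>The matrix of residues and its kernel\<close>

definition pade_exponent :: "nat \<Rightarrow> 'n \<Rightarrow> 'n \<Rightarrow> nat" where
  "pade_exponent k i l = (if l = i then Suc k else k)"

definition pade_residue :: "('n::finite \<Rightarrow> real) \<Rightarrow> nat \<Rightarrow> real \<Rightarrow> real \<Rightarrow> 'n \<Rightarrow> 'n \<Rightarrow> real" where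
  "pade_residue a k \<kappa> x i j =
     fls_residue (fps_to_fls (binom_fps \<kappa> x (a j)) / expand_at (a j) (root_poly a (pade_exponent k i)))"

lemma root_poly_pade_exponent: "root_poly a (pade_exponent k i) = [:- a i, 1:] * node_poly a ^ k"
proof -
  have "root_poly a (pade_exponent k i)
      = [:- a i, 1:] ^ Suc k * (\<Prod>l\<in>UNIV - {i}. [:- a l, 1:] ^ pade_exponent k i l)"
    by (simp only: root_poly_def prod.remove[OF finite UNIV_I[of i]] pade_exponent_def if_True simp_thms)
  also have "(\<Prod>l\<in>UNIV - {i}. [:- a l, 1:] ^ pade_exponent k i l) = lagrange_poly a i ^ k"
    unfolding lagrange_poly_def prod_power_distrib by (intro prod.cong) (auto simp: pade_exponent_def)
  also have "[:- a i, 1:] ^ Suc k * lagrange_poly a i ^ k = [:- a i, 1:] * node_poly a ^ k"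
    by (simp only: node_poly_eq[of a i] power_mult_distrib power_Suc mult.assoc)
  finally show ?thesis .
qed

lemma cofactor_fps_nth_0_nonzero:
  assumes "inj a"
  shows "cofactor_fps a m j $ 0 \<noteq> 0"
proof -
  have "(\<Prod>l\<in>S. inverse (fps_const (a j - a l) + fps_X) ^ m l) $ 0 \<noteq> 0" if "finite S" "S \<subseteq> UNIV - {j}" for S
    using that
  proof (induction S rule: finite_induct)
    case (insert l S)
    then have "a j - a l \<noteq> 0" using assms by (auto simp: inj_eq)
    then show ?case using insert by (simp add: fps_nth_power_0)
  qed simp
  from this[OF finite order_refl] show ?thesis by (simp add: cofactor_fps_def)
qed

lemma pade_residue_left_kernel_trivial:
  fixes a :: "'n::finite \<Rightarrow> real"
  assumes "inj a" "\<And>j. 1 + a j * x > 0" "x \<noteq> 0"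
    and "\<And>d. \<kappa> + 1 + real d \<noteq> real k * real CARD('n)"
    and kernel: "\<And>j. (\<Sum>i\<in>UNIV. c i * pade_residue a k \<kappa> x i j) = 0"
  shows "c i = 0"
proof -
  let ?A = "node_poly a" and ?F = "\<lambda>j. fps_to_fls (binom_fps \<kappa> x (a j))"
  \<comment> \<open>Since \<open>lagrange_poly a i / A^(k+1) = 1 / ((z - a_i) A^k)\<close>, this
    numerator encodes the linear combination of the rows.\<close>
  define C where "C = (\<Sum>i\<in>UNIV. smult (c i) (lagrange_poly a i))"
  have degC: "degree C < CARD('n)"
    unfolding C_def
    by (intro degree_sum_less) (auto intro: le_less_trans[OF degree_smult_le] degree_lagrange_poly)
  have res_C: "fls_residue (?F j * expand_at (a j) C / expand_at (a j) ?A ^ Suc k) = 0" for j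
  proof -
    have "?F j * (fls_const (c i) * expand_at (a j) (lagrange_poly a i)) / expand_at (a j) ?A ^ Suc k
        = fls_const (c i) * (?F j / expand_at (a j) (root_poly a (pade_exponent k i)))" for i
    proof -
      have "expand_at (a j) ?A ^ Suc k
          = expand_at (a j) (lagrange_poly a i) * expand_at (a j) (root_poly a (pade_exponent k i))"
        unfolding root_poly_pade_exponent expand_at_mult expand_at_power
        by (simp add: node_poly_eq[of a i] expand_at_mult del: mult_pCons_left)
      moreover have "expand_at (a j) (lagrange_poly a i) \<noteq> 0"
        by (simp add: expand_at_eq_0_iff lagrange_poly_def)
      ultimately show ?thesis by simp
    qed
    then have "?F j * expand_at (a j) C / expand_at (a j) ?A ^ Suc k
        = (\<Sum>i\<in>UNIV. fls_const (c i) * (?F j / expand_at (a j) (root_poly a (pade_exponent k i))))"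
      unfolding C_def expand_at_sum expand_at_smult sum_distrib_left sum_divide_distrib by simp
    then show ?thesis
      using kernel[of j] unfolding pade_residue_def
      by (simp only: fls_residue_sum fls_residue_fls_const_times)
  qed
  obtain w g where wg: "degree g < CARD('n)" "C = reduction_op a \<kappa> x k w + ?A ^ k * g"
    using reduction_op_decompose[OF assms(1) _ degC, of x \<kappa> k] assms(2) by (metis less_irrefl)
  \<comment> \<open>After removal of the derivative only \<open>F g / A\<close> is left. Its poles
    are at most simple, and its residue at \<open>a j\<close> is \<open>g(a_j)\<close> times nonzero
    factors.\<close>
  have "poly g (a j) = 0" for j
  proof -
    let ?G = "binom_fps \<kappa> x (a j) * fps_of_poly (pcompose g [:a j, 1:])"
    have A0: "expand_at (a j) ?A \<noteq> 0" by (simp add: expand_at_eq_0_iff node_poly_nonzero)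
    have "?F j * expand_at (a j) C / expand_at (a j) ?A ^ Suc k
        = ?F j * expand_at (a j) (reduction_op a \<kappa> x k w) / expand_at (a j) ?A ^ Suc k
          + ?F j * expand_at (a j) g / expand_at (a j) ?A"
      using A0 unfolding wg(2) expand_at_add expand_at_mult expand_at_power
      by (simp add: field_simps)
    then have "0 = fls_residue (?F j * expand_at (a j) g / expand_at (a j) ?A)"
      using res_C[of j] residue_reduction_op[of "a j" x \<kappa> a k w] assms(2)[of j] by simp
    also have "?F j * expand_at (a j) g = fps_to_fls ?G"
      by (simp add: expand_at_def fls_times_fps_to_fls)
    also have "fls_residue (fps_to_fls ?G / expand_at (a j) ?A) = ?G $ 0 * cofactor_fps a (\<lambda>_. 1) j $ 0"
      unfolding node_poly_eq_root_poly residue_quotient_root_poly[OF assms(1)] by simp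
    finally have "?G $ 0 = 0" using cofactor_fps_nth_0_nonzero[OF assms(1)] by simp
    moreover have "coeff (pcompose g [:a j, 1:]) 0 = poly g (a j)"
      by (simp flip: poly_0_coeff_0 add: poly_pcompose)
    ultimately show ?thesis using assms(2)[of j] by (simp add: binom_fps_nth)
  qed
  then have "g = 0" using eq_0_if_vanishes_at_nodes[OF assms(1) wg(1)] by blast
  then have C: "C = reduction_op a \<kappa> x k w" using wg(2) by simp
  have "w = 0"
  proof (rule ccontr)
    assume "w \<noteq> 0"
    from degree_reduction_op_ge[OF assms(3) this assms(4)] show False using degC C by (metis not_less)
  qed
  then have "C = 0" by (simp add: C reduction_op_def)
  \<comment> \<open>Evaluation of \<open>C = 0\<close> at the node \<open>a i\<close> isolates
    \<open>c i\<close>.\<close>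
  then have "0 = (\<Sum>j\<in>UNIV. c j * poly (lagrange_poly a j) (a i))"
    unfolding C_def by (metis (no_types, lifting) poly_0 poly_smult poly_sum sum.cong)
  also have "\<dots> = (\<Sum>j\<in>UNIV. if j = i then c i * poly (lagrange_poly a i) (a i) else 0)"
    by (intro sum.cong) (auto simp: poly_lagrange_poly_other)
  finally show ?thesis using poly_lagrange_poly_same[OF assms(1), of i] by simp
qed

section \<open>Denominators and size of the approximants\<close>

text \<open>The residue with the factor \<open>sqrt (1 + a j * x)\<close> removed. The summation
  index satisfies \<open>h \<le> k\<close>, so \<open>k - h\<close> is a true difference and the
  entry is a polynomial in \<open>x\<close>.\<close>

definition pade_coeff :: "('n::finite \<Rightarrow> real) \<Rightarrow> nat \<Rightarrow> real \<Rightarrow> 'n \<Rightarrow> 'n \<Rightarrow> real" where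
  "pade_coeff a k x i j = (\<Sum>h<pade_exponent k i j. ((real k + 1/2) gchoose h) * x ^ h * (1 + a j * x) ^ (k - h)
      * cofactor_fps a (pade_exponent k i) j $ (pade_exponent k i j - 1 - h))"

lemma pade_exponent_le: "pade_exponent k i j \<le> Suc k"
  by (simp add: pade_exponent_def)

lemma pade_residue_eq:
  assumes "inj a" "1 + a j * x > 0"
  shows "pade_residue a k (real k + 1/2) x i j = pade_coeff a k x i j * sqrt (1 + a j * x)"
proof -
  have "(1 + a j * x) powr (real k + 1/2 - real h) = (1 + a j * x) ^ (k - h) * sqrt (1 + a j * x)"
    if "h < pade_exponent k i j" for h
  proof -
    have "real k + 1/2 - real h = real (k - h) + 1/2"
      using that pade_exponent_le[of k i j] by (simp add: of_nat_diff)
    then show ?thesis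
      using assms(2) by (simp only: powr_add powr_realpow powr_half_sqrt less_imp_le)
  qed
  then show ?thesis
    unfolding pade_residue_def residue_quotient_root_poly[OF assms(1)] pade_coeff_def sum_distrib_right
    by (intro sum.cong) (simp_all add: binom_fps_nth)
qed

lemma inverse_linear_fps_nth:
  fixes d :: real
  assumes "d \<noteq> 0"
  shows "inverse (fps_const d + fps_X) $ e = (-1) ^ e / d ^ Suc e"
proof -
  have "(fps_const d + fps_X) * Abs_fps (\<lambda>e. (-1) ^ e / d ^ Suc e) = 1"
  proof (rule fps_ext)
    fix n
    show "((fps_const d + fps_X) * Abs_fps (\<lambda>e. (-1) ^ e / d ^ Suc e)) $ n = 1 $ n"
      using assms by (cases n) (simp_all add: distrib_right)
  qed
  then have "inverse (fps_const d + fps_X) = Abs_fps (\<lambda>e. (-1) ^ e / d ^ Suc e)"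
    by (rule fps_inverse_unique)
  then show ?thesis by simp
qed

text \<open>The numerator is a binomial coefficient up to sign; integrality and the bound by a power
  of 2 suffice, and both pass through the convolution with a geometric series.\<close>

lemma inverse_linear_power_fps_nth:
  assumes "d \<noteq> 0"
  shows "\<exists>z::int. (inverse (fps_const (real_of_int d) + fps_X) ^ m) $ e = real_of_int z / real_of_int d ^ (m + e) \<and> \<bar>z\<bar> \<le> 2 ^ (m + e)"
proof (induction m arbitrary: e)
  case 0
  show ?case by (cases e) (auto intro: exI[of _ 1] exI[of _ 0])
next
  case (Suc m)
  let ?g = "inverse (fps_const (real_of_int d) + fps_X)"
  obtain z :: "nat \<Rightarrow> int"
    where z: "\<And>e. (?g ^ m) $ e = real_of_int (z e) / real_of_int d ^ (m + e)" "\<And>e. \<bar>z e\<bar> \<le> 2 ^ (m + e)"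
    using Suc.IH by metis
  have "(?g ^ Suc m) $ e = (\<Sum>f=0..e. (?g ^ m) $ f * ?g $ (e - f))"
    by (simp only: power_Suc2 fps_mult_nth)
  also have "\<dots> = (\<Sum>f=0..e. (real_of_int (z f) * (-1) ^ (e - f)) / real_of_int d ^ (Suc m + e))"
  proof (intro sum.cong refl)
    fix f assume "f \<in> {0..e}"
    then have "Suc m + e = (m + f) + Suc (e - f)" by simp
    then have "real_of_int d ^ (Suc m + e) = real_of_int d ^ (m + f) * real_of_int d ^ Suc (e - f)" by (simp only: power_add)
    then show "(?g ^ m) $ f * ?g $ (e - f) = (real_of_int (z f) * (-1) ^ (e - f)) / real_of_int d ^ (Suc m + e)"
      using assms by (simp only: z inverse_linear_fps_nth of_int_eq_0_iff not_False_eq_True times_divide_times_eq)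
  qed
  also have "\<dots> = real_of_int (\<Sum>f=0..e. z f * (-1) ^ (e - f)) / real_of_int d ^ (Suc m + e)"
    by (simp add: sum_divide_distrib)
  finally have eq: "(?g ^ Suc m) $ e = real_of_int (\<Sum>f=0..e. z f * (-1) ^ (e - f)) / real_of_int d ^ (Suc m + e)" .
  have geom: "(\<Sum>f=0..e. (2::int) ^ (m + f)) \<le> 2 ^ (Suc m + e)"
    by (induction e) auto
  have "\<bar>\<Sum>f=0..e. z f * (-1) ^ (e - f)\<bar> \<le> (\<Sum>f=0..e. \<bar>z f * (-1) ^ (e - f)\<bar>)" by (rule sum_abs)
  also have "\<dots> \<le> (\<Sum>f=0..e. 2 ^ (m + f))" using z(2) by (intro sum_mono) (simp add: abs_mult)
  finally show ?case using eq geom by (intro exI[of _ "\<Sum>f=0..e. z f * (-1) ^ (e - f)"]) linarith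
qed

text \<open>The denominators are kept separate for each \<open>e\<close>, because divisibility and
  size both depend on how the exponents are shared between the two differences.\<close>

lemma cofactor_fps_nth_three:
  fixes a :: "'n::finite \<Rightarrow> int"
  assumes "UNIV = {j, l1, l2}" "distinct [j, l1, l2]" "a j \<noteq> a l1" "a j \<noteq> a l2"
  shows "\<exists>z::nat \<Rightarrow> int. cofactor_fps (\<lambda>l. real_of_int (a l)) m j $ n
            = (\<Sum>e=0..n. real_of_int (z e) / (real_of_int (a j - a l1) ^ (m l1 + e) * real_of_int (a j - a l2) ^ (m l2 + (n - e))))
          \<and> (\<forall>e\<le>n. \<bar>z e\<bar> \<le> 2 ^ (m l1 + m l2 + n))"
proof -
  have others: "UNIV - {j} = {l1, l2}" using assms(1,2) by auto
  define g where "g l = inverse (fps_const (real_of_int (a j - a l)) + fps_X) ^ m l" for l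
  obtain z1 :: "nat \<Rightarrow> int" where z1: "\<And>e. g l1 $ e = real_of_int (z1 e) / real_of_int (a j - a l1) ^ (m l1 + e)" "\<And>e. \<bar>z1 e\<bar> \<le> 2 ^ (m l1 + e)"
    unfolding g_def using inverse_linear_power_fps_nth[of "a j - a l1" "m l1"] assms(3) by (metis eq_iff_diff_eq_0)
  obtain z2 :: "nat \<Rightarrow> int" where z2: "\<And>e. g l2 $ e = real_of_int (z2 e) / real_of_int (a j - a l2) ^ (m l2 + e)" "\<And>e. \<bar>z2 e\<bar> \<le> 2 ^ (m l2 + e)"
    unfolding g_def using inverse_linear_power_fps_nth[of "a j - a l2" "m l2"] assms(4) by (metis eq_iff_diff_eq_0)
  have "cofactor_fps (\<lambda>l. real_of_int (a l)) m j = g l1 * g l2"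
    unfolding cofactor_fps_def others using assms(2) by (simp add: g_def)
  then have "cofactor_fps (\<lambda>l. real_of_int (a l)) m j $ n
      = (\<Sum>e=0..n. real_of_int (z1 e * z2 (n - e)) / (real_of_int (a j - a l1) ^ (m l1 + e) * real_of_int (a j - a l2) ^ (m l2 + (n - e))))"
    by (simp add: fps_mult_nth z1(1) z2(1))
  moreover have "\<bar>z1 e * z2 (n - e)\<bar> \<le> 2 ^ (m l1 + m l2 + n)" if "e \<le> n" for e
  proof -
    have "\<bar>z1 e * z2 (n - e)\<bar> \<le> 2 ^ (m l1 + e) * 2 ^ (m l2 + (n - e))"
      unfolding abs_mult using z1(2) z2(2) by (intro mult_mono) auto
    also have "\<dots> = 2 ^ (m l1 + m l2 + n)" using that by (simp flip: power_add)
    finally show ?thesis .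
  qed
  ultimately show ?thesis by (intro exI[of _ "\<lambda>e. z1 e * z2 (n - e)"]) auto
qed

text \<open>The total multiplicity is \<open>3k + 1\<close>; taking the residue uses 1 and the
  Taylor coefficient of the binomial uses \<open>h\<close>. Each of the two differences occurs at
  least \<open>k\<close> times, which leaves a surplus of \<open>k - h\<close> to be shared.\<close>

lemma pade_exponent_split:
  assumes "UNIV = {j, l1, l2}" "distinct [j, l1, l2]" "h < pade_exponent k i j"
  defines "m \<equiv> pade_exponent k i"
  defines "n \<equiv> m j - 1 - h"
  shows "h \<le> k" "m l1 + m l2 + n = 3 * k - h"
    "e \<le> n \<Longrightarrow> \<exists>e1 e2. m l1 + e = k + e1 \<and> m l2 + (n - e) = k + e2 \<and> e1 + e2 = k - h"
proof -
  have i: "i = j \<or> i = l1 \<or> i = l2" using assms(1) by auto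
  show "h \<le> k" using assms(3) pade_exponent_le[of k i j] by simp
  show "m l1 + m l2 + n = 3 * k - h"
    using i assms(2,3) unfolding m_def n_def by (auto simp: pade_exponent_def)
  show "\<exists>e1 e2. m l1 + e = k + e1 \<and> m l2 + (n - e) = k + e2 \<and> e1 + e2 = k - h" if "e \<le> n"
    using i assms(2,3) that unfolding m_def n_def
    by (intro exI[of _ "m l1 + e - k"] exI[of _ "m l2 + (n - e) - k"]) (auto simp: pade_exponent_def m_def n_def)
qed

text \<open>Here \<open>T\<close> will be \<open>N + 4 * a j\<close>, whose power
  \<open>k - h\<close> comes from \<open>(1 + a_j x)^(k - h)\<close> and can pay for the surplus of
  \<open>k - h\<close> differences. If only the first difference divides \<open>T\<close>, the
  second must be paid by \<open>E\<close> alone, up to \<open>2k\<close> times; hence the square in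
  the second alternative.\<close>

lemma cofactor_fps_nth_denominator:
  fixes a :: "'n::finite \<Rightarrow> int" and E T :: int
  assumes "UNIV = {j, l1, l2}" "distinct [j, l1, l2]" "a j \<noteq> a l1" "a j \<noteq> a l2"
    and "h < pade_exponent k i j"
    and "((a j - a l1) * (a j - a l2) dvd T \<and> (a j - a l1) * (a j - a l2) dvd E)
          \<or> ((a j - a l1) dvd T \<and> (a j - a l1) * (a j - a l2) ^ 2 dvd E)"
  shows "real_of_int (E ^ k * T ^ (k - h))
          * cofactor_fps (\<lambda>l. real_of_int (a l)) (pade_exponent k i) j $ (pade_exponent k i j - 1 - h) \<in> \<int>"
proof -
  define m where "m = pade_exponent k i"
  define n where "n = m j - 1 - h"
  let ?d1 = "a j - a l1" and ?d2 = "a j - a l2"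
  obtain z :: "nat \<Rightarrow> int" where z: "cofactor_fps (\<lambda>l. real_of_int (a l)) m j $ n
      = (\<Sum>e=0..n. real_of_int (z e) / (real_of_int ?d1 ^ (m l1 + e) * real_of_int ?d2 ^ (m l2 + (n - e))))"
    using cofactor_fps_nth_three[OF assms(1-4), of m n] by blast
  have dvd: "?d1 ^ (m l1 + e) * ?d2 ^ (m l2 + (n - e)) dvd E ^ k * T ^ (k - h)" if en: "e \<le> n" for e
  proof -
    obtain e1 e2 where e: "m l1 + e = k + e1" "m l2 + (n - e) = k + e2" "e1 + e2 = k - h"
      using pade_exponent_split(3)[OF assms(1,2,5)] en unfolding m_def n_def by blast
    have e_le: "e1 \<le> k - h" "e2 \<le> k - h" "k + e2 \<le> 2 * k" using e(3) by auto
    from assms(6) show ?thesis unfolding e(1,2)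
    proof
      assume A: "?d1 * ?d2 dvd T \<and> ?d1 * ?d2 dvd E"
      have "?d1 ^ (k + e1) * ?d2 ^ (k + e2) = (?d1 * ?d2) ^ k * (?d1 ^ e1 * ?d2 ^ e2)"
        by (simp add: power_add power_mult_distrib mult_ac)
      also have "\<dots> dvd E ^ k * T ^ (k - h)"
      proof (intro mult_dvd_mono dvd_power_same)
        have "?d1 ^ e1 * ?d2 ^ e2 dvd ?d1 ^ (k - h) * ?d2 ^ (k - h)"
          using e_le by (intro mult_dvd_mono le_imp_power_dvd)
        also have "\<dots> = (?d1 * ?d2) ^ (k - h)" by (simp add: power_mult_distrib)
        also have "\<dots> dvd T ^ (k - h)" using A by (intro dvd_power_same) simp
        finally show "?d1 ^ e1 * ?d2 ^ e2 dvd T ^ (k - h)" .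
      qed (use A in simp)
      finally show "?d1 ^ (k + e1) * ?d2 ^ (k + e2) dvd E ^ k * T ^ (k - h)" .
    next
      assume A: "?d1 dvd T \<and> ?d1 * ?d2 ^ 2 dvd E"
      have "?d1 ^ (k + e1) * ?d2 ^ (k + e2) = (?d1 ^ k * ?d2 ^ (k + e2)) * ?d1 ^ e1"
        by (simp add: power_add mult_ac)
      also have "\<dots> dvd E ^ k * T ^ (k - h)"
      proof (intro mult_dvd_mono)
        have "?d1 ^ k * ?d2 ^ (k + e2) dvd ?d1 ^ k * ?d2 ^ (2 * k)"
          using e_le by (intro mult_dvd_mono le_imp_power_dvd) auto
        also have "\<dots> = (?d1 * ?d2 ^ 2) ^ k" by (simp add: power_mult_distrib power_mult)
        also have "\<dots> dvd E ^ k" using A by (intro dvd_power_same) simp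
        finally show "?d1 ^ k * ?d2 ^ (k + e2) dvd E ^ k" .
        have "?d1 ^ e1 dvd ?d1 ^ (k - h)" using e_le by (intro le_imp_power_dvd)
        also have "\<dots> dvd T ^ (k - h)" using A by (intro dvd_power_same) simp
        finally show "?d1 ^ e1 dvd T ^ (k - h)" .
      qed
      finally show "?d1 ^ (k + e1) * ?d2 ^ (k + e2) dvd E ^ k * T ^ (k - h)" .
    qed
  qed
  have summand: "real_of_int (E ^ k * T ^ (k - h)) * (real_of_int (z e) / (real_of_int ?d1 ^ (m l1 + e) * real_of_int ?d2 ^ (m l2 + (n - e)))) \<in> \<int>"
    if e: "e \<le> n" for e
  proof -
    obtain w where w: "E ^ k * T ^ (k - h) = ?d1 ^ (m l1 + e) * ?d2 ^ (m l2 + (n - e)) * w"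
      using dvd[OF e] by (elim dvdE)
    have "real_of_int ?d1 ^ (m l1 + e) * real_of_int ?d2 ^ (m l2 + (n - e)) \<noteq> 0"
      using assms(3,4) by simp
    moreover have "real_of_int (E ^ k * T ^ (k - h))
        = (real_of_int ?d1 ^ (m l1 + e) * real_of_int ?d2 ^ (m l2 + (n - e))) * real_of_int w"
      unfolding w by (simp only: of_int_mult of_int_power)
    moreover have "p * u * (v / p) = u * v" if "p \<noteq> 0" for p u v :: real using that by simp
    ultimately show ?thesis by (simp only:) (metis Ints_mult Ints_of_int)
  qed
  show ?thesis
    unfolding m_def [symmetric] n_def [symmetric] z sum_distrib_left
    using summand by (intro Ints_sum) auto
qed

lemma cofactor_fps_nth_bound:
  fixes a :: "'n::finite \<Rightarrow> int" and r G \<delta> :: real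
  assumes "UNIV = {j, l1, l2}" "distinct [j, l1, l2]" "a j \<noteq> a l1" "a j \<noteq> a l2"
    and "h < pade_exponent k i j"
    and "0 < \<delta>" "\<delta> \<le> r" "\<delta> \<le> \<bar>real_of_int (a j - a l1)\<bar>" "\<delta> \<le> \<bar>real_of_int (a j - a l2)\<bar>"
    and "0 < G" "G \<le> \<bar>real_of_int (a j - a l1)\<bar> * \<bar>real_of_int (a j - a l2)\<bar>"
  shows "\<bar>cofactor_fps (\<lambda>l. real_of_int (a l)) (pade_exponent k i) j $ (pade_exponent k i j - 1 - h)\<bar>
           \<le> real (Suc k) * 8 ^ k * r ^ h / (G * \<delta>) ^ k"
proof -
  define m where "m = pade_exponent k i"
  define n where "n = m j - 1 - h"
  define D1 where "D1 = \<bar>real_of_int (a j - a l1)\<bar>"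
  define D2 where "D2 = \<bar>real_of_int (a j - a l2)\<bar>"
  note D = assms(8,9,11)[folded D1_def D2_def]
  have D_pos: "D1 > 0" "D2 > 0" using D assms(6) by auto
  obtain z :: "nat \<Rightarrow> int" where z: "cofactor_fps (\<lambda>l. real_of_int (a l)) m j $ n
      = (\<Sum>e=0..n. real_of_int (z e) / (real_of_int (a j - a l1) ^ (m l1 + e) * real_of_int (a j - a l2) ^ (m l2 + (n - e))))"
     "\<And>e. e \<le> n \<Longrightarrow> \<bar>z e\<bar> \<le> 2 ^ (m l1 + m l2 + n)"
    using cofactor_fps_nth_three[OF assms(1-4), of m n] by blast
  have h: "h \<le> k" and m_sum: "m l1 + m l2 + n = 3 * k - h"
    using pade_exponent_split(1,2)[OF assms(1,2,5)] unfolding m_def n_def by auto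
  have z_le: "\<bar>real_of_int (z e)\<bar> \<le> 8 ^ k" if "e \<le> n" for e
  proof -
    have "\<bar>real_of_int (z e)\<bar> \<le> 2 ^ (3 * k - h)"
      using z(2)[OF that] unfolding m_sum by (metis of_int_abs of_int_le_iff of_int_numeral of_int_power)
    also have "\<dots> \<le> 2 ^ (3 * k)" by (intro power_increasing) auto
    also have "\<dots> = 8 ^ k" by (simp add: power_mult)
    finally show ?thesis .
  qed
  have bound: "\<bar>real_of_int (z e) / (real_of_int (a j - a l1) ^ (m l1 + e) * real_of_int (a j - a l2) ^ (m l2 + (n - e)))\<bar> \<le> 8 ^ k * r ^ h / (G * \<delta>) ^ k"
    if en: "e \<in> {0..n}" for e
  proof -
    obtain e1 e2 where e: "m l1 + e = k + e1" "m l2 + (n - e) = k + e2" "e1 + e2 = k - h"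
      using pade_exponent_split(3)[OF assms(1,2,5), of e] en unfolding m_def n_def by auto
    \<comment> \<open>The \<open>k\<close> forced pairs of differences are bounded below by
      \<open>G\<close>, the surplus by \<open>\<delta>\<close>. The missing
      \<open>\<delta> ^ h\<close> is replaced by \<open>r ^ h\<close>, which will later join
      \<open>x ^ h\<close>.\<close>
    have "(G * \<delta>) ^ k = G ^ k * (\<delta> ^ (e1 + e2) * \<delta> ^ h)"
      using h unfolding e(3) by (simp add: power_mult_distrib flip: power_add)
    also have "\<dots> \<le> (D1 * D2) ^ k * (D1 ^ e1 * D2 ^ e2 * r ^ h)"
      unfolding power_add using assms(6,7,10) D D_pos
      by (intro mult_mono power_mono mult_nonneg_nonneg zero_le_power) auto
    also have "\<dots> = D1 ^ (m l1 + e) * D2 ^ (m l2 + (n - e)) * r ^ h"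
      unfolding e(1,2) by (simp add: power_add power_mult_distrib)
    finally have "(G * \<delta>) ^ k \<le> D1 ^ (m l1 + e) * D2 ^ (m l2 + (n - e)) * r ^ h" .
    then have "1 / (D1 ^ (m l1 + e) * D2 ^ (m l2 + (n - e))) \<le> r ^ h / (G * \<delta>) ^ k"
      using D_pos assms(6,10) by (simp add: field_simps)
    then have "\<bar>real_of_int (z e)\<bar> * (1 / (D1 ^ (m l1 + e) * D2 ^ (m l2 + (n - e)))) \<le> 8 ^ k * (r ^ h / (G * \<delta>) ^ k)"
      using z_le en D_pos by (intro mult_mono) auto
    then show ?thesis by (simp add: D1_def D2_def abs_mult power_abs)
  qed
  have "\<bar>cofactor_fps (\<lambda>l. real_of_int (a l)) m j $ n\<bar> \<le> (\<Sum>e=0..n. 8 ^ k * r ^ h / (G * \<delta>) ^ k)"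
    unfolding z(1) using bound by (intro order_trans[OF sum_abs] sum_mono)
  also have "\<dots> = real (Suc n) * (8 ^ k * r ^ h / (G * \<delta>) ^ k)" by simp
  also have "\<dots> \<le> real (Suc k) * (8 ^ k * r ^ h / (G * \<delta>) ^ k)"
  proof (intro mult_right_mono)
    have "m j \<le> Suc k" unfolding m_def by (rule pade_exponent_le)
    then show "real (Suc n) \<le> real (Suc k)" unfolding n_def by simp
    show "0 \<le> 8 ^ k * r ^ h / (G * \<delta>) ^ k" using assms(6,7,10) by simp
  qed
  finally show ?thesis unfolding m_def n_def by simp
qed

section \<open>Binomial coefficients at half-integers\<close>

lemma gbinomial_minus_half: "((-1/2) gchoose h) * (-4) ^ h = real (2 * h choose h)"
proof (induction h)
  case (Suc h)
  have absorb: "real (Suc h) * ((-1/2) gchoose Suc h) = (-1/2 - real h) * ((-1/2) gchoose h)"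
    using gbinomial_absorption[of h "-1/2::real"] gbinomial_absorb_comp[of "-1/2::real" h] by simp
  have "real (Suc h) * (((-1/2) gchoose Suc h) * (-4) ^ Suc h)
      = (-4) * (real (Suc h) * ((-1/2) gchoose Suc h)) * (-4) ^ h"
    by (simp only: power_Suc mult_ac)
  also have "\<dots>
      = (-4) * (-1/2 - real h) * (((-1/2) gchoose h) * (-4) ^ h)"
    unfolding absorb by (simp only: mult_ac)
  also have "\<dots> = (2 + 4 * real h) * real (2 * h choose h)"
    unfolding Suc.IH by (simp add: algebra_simps)
  also have "\<dots> = real (Suc h) * real (2 * Suc h choose Suc h)"
  proof -
    have n1: "2 * Suc h - 1 = Suc (2 * h)" and n2: "Suc (2 * h) - h = Suc h" by simp_all
    have "Suc h * (2 * Suc h choose Suc h) = 2 * Suc h * (Suc (2 * h) choose h)"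
      using binomial_absorption[of h "2 * Suc h"] by (simp only: n1)
    moreover have "Suc h * (Suc (2 * h) choose h) = (2 * h + 1) * (2 * h choose h)"
      using binomial_absorb_comp[of "Suc (2 * h)" h] by (simp only: n2) simp
    ultimately have "Suc h * (2 * Suc h choose Suc h) = 2 * ((2 * h + 1) * (2 * h choose h))"
      by (simp only: mult.assoc)
    from arg_cong[OF this, of real] show ?thesis by (simp only: of_nat_mult of_nat_add) (simp add: algebra_simps)
  qed
  finally show ?case
    by (subst (asm) mult_left_cancel) (simp_all only: of_nat_eq_0_iff nat.distinct not_False_eq_True)
qed simp

text \<open>At \<open>-1/2\<close> the values are central binomial coefficients up to sign, and
  Pascal's rule raises the upper argument by 1 at a time without new denominators. The power of 4
  will come from \<open>x = 4/N\<close>.\<close>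

lemma four_power_gbinomial_Ints: "4 ^ h * ((real k + 1/2) gchoose h) \<in> \<int>"
proof -
  have "4 ^ h * ((real k - 1/2) gchoose h) \<in> \<int>" for k
  proof (induction k arbitrary: h)
    case 0
    have "4 ^ h * ((-1/2 :: real) gchoose h) = (-1) ^ h * (((-1/2) gchoose h) * (-4) ^ h)"
      by (simp flip: power_mult_distrib)
    then show ?case unfolding gbinomial_minus_half by simp
  next
    case (Suc k)
    show ?case
    proof (cases h)
      case (Suc h')
      have "4 ^ h * ((real (Suc k) - 1/2) gchoose h)
          = 4 ^ h * ((real k - 1/2) gchoose h) + 4 * (4 ^ h' * ((real k - 1/2) gchoose h'))"
        using gbinomial_Suc_Suc[of "real k - 1/2" h'] unfolding Suc by (simp add: algebra_simps)
      then show ?thesis using Suc.IH by simp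
    qed simp
  qed
  from this[of "Suc k"] have "4 ^ h * ((real (Suc k) - 1/2) gchoose h) \<in> \<int>" .
  also have "real (Suc k) - 1/2 = real k + 1/2" by simp
  finally show ?thesis .
qed

lemma abs_gbinomial_le_binomial:
  assumes "h \<le> k"
  shows "\<bar>(real k + 1/2) gchoose h\<bar> \<le> real (Suc k choose h)"
proof -
  have "\<bar>(real k + 1/2) gchoose h\<bar> = (\<Prod>i=0..<h. \<bar>real k + 1/2 - real i\<bar>) / fact h"
    by (simp add: gbinomial_prod_rev abs_prod)
  also have "\<dots> \<le> (\<Prod>i=0..<h. real (Suc k) - real i) / fact h"
    using assms by (intro divide_right_mono prod_mono) (auto simp: abs_if)
  also have "\<dots> = real (Suc k choose h)" by (simp add: binomial_gbinomial gbinomial_prod_rev)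
  finally show ?thesis .
qed

text \<open>The factor \<open>N ^ k\<close> is split: \<open>N ^ h\<close> reduces
  \<open>x ^ h\<close> to \<open>4 ^ h\<close>, which makes the binomial coefficient integral, and
  \<open>N ^ (k - h)\<close> turns \<open>(1 + a_j x)^(k - h)\<close> into
  \<open>(N + 4 a_j)^(k - h)\<close>.\<close>

lemma pade_coeff_Ints:
  fixes a :: "'n::finite \<Rightarrow> int" and E N :: int
  assumes "UNIV = {j, l1, l2}" "distinct [j, l1, l2]" "a j \<noteq> a l1" "a j \<noteq> a l2" "N > 0"
    and "((a j - a l1) * (a j - a l2) dvd N + 4 * a j \<and> (a j - a l1) * (a j - a l2) dvd E)
          \<or> ((a j - a l1) dvd N + 4 * a j \<and> (a j - a l1) * (a j - a l2) ^ 2 dvd E)"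
  shows "real_of_int ((N * E) ^ k) * pade_coeff (\<lambda>l. real_of_int (a l)) k (4 / real_of_int N) i j \<in> \<int>"
  unfolding pade_coeff_def sum_distrib_left
proof (intro Ints_sum)
  fix h assume "h \<in> {..<pade_exponent k i j}"
  then have h: "h < pade_exponent k i j" "h \<le> k" using pade_exponent_le[of k i j] by auto
  let ?c = "cofactor_fps (\<lambda>l. real_of_int (a l)) (pade_exponent k i) j $ (pade_exponent k i j - 1 - h)"
  let ?N = "real_of_int N"
  have "?N ^ k = ?N ^ h * ?N ^ (k - h)" using h(2) by (simp flip: power_add)
  then have "?N ^ k * ((4 / ?N) ^ h * (1 + a j * (4 / ?N)) ^ (k - h))
      = (?N ^ h * (4 / ?N) ^ h) * (?N ^ (k - h) * (1 + a j * (4 / ?N)) ^ (k - h))"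
    by (simp only: mult_ac)
  moreover have "?N * (1 + a j * (4 / ?N)) = ?N + 4 * a j" using assms(5) by (simp add: field_simps)
  then have "?N ^ (k - h) * (1 + a j * (4 / ?N)) ^ (k - h) = (?N + 4 * a j) ^ (k - h)"
    by (metis power_mult_distrib)
  moreover have "?N ^ h * (4 / ?N) ^ h = 4 ^ h" using assms(5) by (simp flip: power_mult_distrib)
  ultimately have "?N ^ k * ((4 / ?N) ^ h * (1 + a j * (4 / ?N)) ^ (k - h)) = 4 ^ h * (?N + 4 * a j) ^ (k - h)"
    by (simp only:)
  then have "real_of_int ((N * E) ^ k) * (((real k + 1/2) gchoose h) * (4 / ?N) ^ h * (1 + a j * (4 / ?N)) ^ (k - h) * ?c)
      = (4 ^ h * ((real k + 1/2) gchoose h)) * (real_of_int (E ^ k * (N + 4 * a j) ^ (k - h)) * ?c)"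
    by (simp add: power_mult_distrib)
  also have "\<dots> \<in> \<int>"
    using assms h(1) by (intro Ints_mult four_power_gbinomial_Ints cofactor_fps_nth_denominator)
  finally show "real_of_int ((N * E) ^ k) * (((real k + 1/2) gchoose h) * (4 / ?N) ^ h * (1 + a j * (4 / ?N)) ^ (k - h) * ?c) \<in> \<int>" .
qed

lemma pade_coeff_bound:
  fixes a :: "'n::finite \<Rightarrow> int" and r G \<delta> x :: real
  assumes "UNIV = {j, l1, l2}" "distinct [j, l1, l2]" "a j \<noteq> a l1" "a j \<noteq> a l2"
    and "0 < \<delta>" "\<delta> \<le> r" "\<delta> \<le> \<bar>real_of_int (a j - a l1)\<bar>" "\<delta> \<le> \<bar>real_of_int (a j - a l2)\<bar>"
    and "0 < G" "G \<le> \<bar>real_of_int (a j - a l1)\<bar> * \<bar>real_of_int (a j - a l2)\<bar>"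
    and "0 \<le> x" "0 \<le> a j" "a j \<le> r"
  shows "\<bar>pade_coeff (\<lambda>l. real_of_int (a l)) k x i j\<bar>
           \<le> real (Suc k) * 8 ^ k / (G * \<delta>) ^ k * (1 + r * x) ^ (2 * k + 1)"
proof -
  let ?c = "\<lambda>h. cofactor_fps (\<lambda>l. real_of_int (a l)) (pade_exponent k i) j $ (pade_exponent k i j - 1 - h)"
  define K where "K = real (Suc k) * 8 ^ k / (G * \<delta>) ^ k"
  have r: "r \<ge> 0" and K: "K \<ge> 0" using assms by (auto simp: K_def)
  have "\<bar>pade_coeff (\<lambda>l. real_of_int (a l)) k x i j\<bar>
      \<le> (\<Sum>h<pade_exponent k i j. real (Suc k choose h) * x ^ h * (1 + r * x) ^ k * (K * r ^ h))"
    unfolding pade_coeff_def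
  proof (intro order_trans[OF sum_abs] sum_mono)
    fix h assume "h \<in> {..<pade_exponent k i j}"
    then have h: "h < pade_exponent k i j" "h \<le> k" using pade_exponent_le[of k i j] by auto
    have "(1 + a j * x) ^ (k - h) \<le> (1 + r * x) ^ (k - h)"
      using assms by (intro power_mono add_left_mono mult_right_mono) auto
    also have "\<dots> \<le> (1 + r * x) ^ k" using r assms by (intro power_increasing) auto
    finally have u: "(1 + a j * x) ^ (k - h) \<le> (1 + r * x) ^ k" .
    have "\<bar>?c h\<bar> \<le> real (Suc k) * 8 ^ k * r ^ h / (G * \<delta>) ^ k"
      using cofactor_fps_nth_bound[OF assms(1-4) h(1) assms(5-10)] .
    then have c: "\<bar>?c h\<bar> \<le> K * r ^ h" by (simp add: K_def)
    have "\<bar>((real k + 1/2) gchoose h) * x ^ h * (1 + a j * x) ^ (k - h) * ?c h\<bar>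
        = \<bar>(real k + 1/2) gchoose h\<bar> * x ^ h * (1 + a j * x) ^ (k - h) * \<bar>?c h\<bar>"
      using assms(11,12) by (simp add: abs_mult)
    also have "\<dots> \<le> real (Suc k choose h) * x ^ h * (1 + r * x) ^ k * (K * r ^ h)"
      using abs_gbinomial_le_binomial[OF h(2)] u c assms(11,12) r
      by (intro mult_mono mult_nonneg_nonneg zero_le_power add_nonneg_nonneg) auto
    finally show "\<bar>((real k + 1/2) gchoose h) * x ^ h * (1 + a j * x) ^ (k - h) * ?c h\<bar>
        \<le> real (Suc k choose h) * x ^ h * (1 + r * x) ^ k * (K * r ^ h)" .
  qed
  \<comment> \<open>Extended to all \<open>h \<le> k + 1\<close>, the sum is a complete binomial
    expansion of \<open>(1 + r x)^(k+1)\<close>.\<close>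
  also have "\<dots> \<le> (\<Sum>h\<le>Suc k. real (Suc k choose h) * x ^ h * (1 + r * x) ^ k * (K * r ^ h))"
  proof (intro sum_mono2)
    show "{..<pade_exponent k i j} \<subseteq> {..Suc k}" using pade_exponent_le[of k i j] by auto
    show "0 \<le> real (Suc k choose h) * x ^ h * (1 + r * x) ^ k * (K * r ^ h)" for h
      using r K assms(11) by (intro mult_nonneg_nonneg zero_le_power add_nonneg_nonneg) auto
  qed simp
  also have "\<dots> = K * (1 + r * x) ^ k * (\<Sum>h\<le>Suc k. real (Suc k choose h) * (r * x) ^ h * 1 ^ (Suc k - h))"
    by (simp add: sum_distrib_left power_mult_distrib mult_ac del: sum.atMost_Suc)
  also have "(\<Sum>h\<le>Suc k. real (Suc k choose h) * (r * x) ^ h * 1 ^ (Suc k - h)) = (r * x + 1) ^ Suc k"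
    by (simp only: binomial_ring)
  also have "K * (1 + r * x) ^ k * (r * x + 1) ^ Suc k = K * (1 + r * x) ^ (2 * k + 1)"
    by (simp add: add.commute power_add mult_2)
  finally show ?thesis unfolding K_def .
qed

section \<open>Approximation by three nodes\<close>

text \<open>Hermite reduction excludes relations between rows, whereas the arithmetic needs a row
  that does not annihilate a given vector. For a square matrix the two are equivalent.\<close>

lemma trivial_left_kernel_imp_trivial_right_kernel:
  fixes f :: "'n::finite \<Rightarrow> 'n \<Rightarrow> real"
  assumes left: "\<And>c i. (\<And>j. (\<Sum>i\<in>UNIV. c i * f i j) = 0) \<Longrightarrow> c i = 0"
    and "\<And>i. (\<Sum>j\<in>UNIV. f i j * v j) = 0"
  shows "v j = 0"
proof -
  include vec_syntax
  define M :: "real^'n^'n" where "M = (\<chi> i j. f i j)"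
  have "c = 0" if "transpose M *v c = 0" for c
  proof -
    have "(\<Sum>i\<in>UNIV. vec_nth c i * f i j) = 0" for j
      using arg_cong[OF that, of "\<lambda>u. vec_nth u j"]
      by (simp add: M_def matrix_vector_mult_def transpose_def mult.commute)
    then show ?thesis using left[of "vec_nth c"] by (simp add: vec_eq_iff)
  qed
  then have "\<exists>B. B ** transpose M = mat 1" by (simp add: matrix_left_invertible_ker)
  then have "\<exists>B. B ** M = mat 1"
    by (metis left_invertible_transpose matrix_left_right_inverse)
  moreover have "M *v (\<chi> j. v j) = 0"
    using assms(2) by (simp add: M_def matrix_vector_mult_def vec_eq_iff)
  ultimately have "(\<chi> j. v j) = (0 :: real^'n)" by (metis matrix_left_invertible_ker)
  then show ?thesis by (simp add: vec_eq_iff)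
qed

text \<open>The degree \<open>k\<close> of the approximants is chosen least with \<open>2 q \<le> L\<^sup>k\<close>, so that the small values of the
  forms contribute at most \<open>1/2\<close> to a nonzero integer.\<close>
lemma simultaneous_approximation_bound:
  fixes \<theta> :: "'n::finite \<Rightarrow> real" and r :: "nat \<Rightarrow> 'n \<Rightarrow> 'n \<Rightarrow> int" and v :: "'n \<Rightarrow> int" and q :: int
  assumes coeff: "\<And>k i j. k > 0 \<Longrightarrow> \<bar>real_of_int (r k i j)\<bar> \<le> p * P ^ k"
    and small: "\<And>k i. k > 0 \<Longrightarrow> \<bar>\<Sum>j\<in>UNIV. real_of_int (r k i j) * \<theta> j\<bar> \<le> 1 / L ^ k"
    and nondegenerate: "\<And>k. k > 0 \<Longrightarrow> \<exists>i. (\<Sum>j\<in>UNIV. r k i j * v j) \<noteq> 0"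
    and "L > 1" "P \<ge> 1" "p > 0" "q > 0"
    and close: "\<And>j. \<bar>\<theta> j - real_of_int (v j) / real_of_int q\<bar> \<le> \<epsilon>"
  shows "1 \<le> 2 * real CARD('n) * p * P * (2 * real_of_int q) powr (ln P / ln L) * real_of_int q * \<epsilon>"
proof -
  \<comment> \<open>Chosen so that \<open>L powr s = P\<close>; minimality of \<open>k\<close>
    bounds \<open>L ^ (k - 1)\<close> by \<open>2 q\<close>, hence \<open>P ^ (k - 1)\<close> by
    \<open>(2 q) powr s\<close>.\<close>
  define s where "s = ln P / ln L"
  have s: "s \<ge> 0" "L powr s = P" using assms(4,5) by (auto simp: s_def powr_def)
  have q: "real_of_int q \<ge> 1" using assms(7) by simp
  define k where "k = (LEAST k. 2 * real_of_int q \<le> L ^ k)"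
  obtain k0 where "2 * real_of_int q < L ^ k0" using real_arch_pow[OF assms(4)] by blast
  then have k: "2 * real_of_int q \<le> L ^ k"
    using LeastI[of "\<lambda>k. 2 * real_of_int q \<le> L ^ k" k0] by (simp add: k_def)
  have "k \<noteq> 0" using k q by (intro notI) simp
  then have k_pos: "k > 0" by simp
  then have "\<not> 2 * real_of_int q \<le> L ^ (k - 1)"
    using not_less_Least[of "k - 1" "\<lambda>k. 2 * real_of_int q \<le> L ^ k"] by (simp add: k_def)
  then have "L ^ (k - 1) \<le> 2 * real_of_int q" by simp
  then have "(L ^ (k - 1)) powr s \<le> (2 * real_of_int q) powr s"
    using s(1) assms(4) by (intro powr_mono2) auto
  moreover have "(L ^ (k - 1)) powr s = P ^ (k - 1)"
    using assms(4) powr_power[of L s "k - 1"] by (simp add: s(2) powr_powr flip: powr_realpow)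
  ultimately have "P * P ^ (k - 1) \<le> P * (2 * real_of_int q) powr s"
    using assms(5) by (intro mult_left_mono) auto
  moreover have "P * P ^ (k - 1) = P ^ k" using k_pos by (metis power_eq_if less_irrefl)
  ultimately have Pk: "P ^ k \<le> P * (2 * real_of_int q) powr s" by simp
  have \<epsilon>: "\<epsilon> \<ge> 0" using close by (meson abs_ge_zero order_trans)
  obtain i where i: "(\<Sum>j\<in>UNIV. r k i j * v j) \<noteq> 0" using nondegenerate[OF k_pos] by blast
  define S where "S = (\<Sum>j\<in>UNIV. real_of_int (r k i j) * \<theta> j)"
  define T where "T = (\<Sum>j\<in>UNIV. real_of_int (r k i j) * (\<theta> j - real_of_int (v j) / real_of_int q))"
  \<comment> \<open>\<open>S - T\<close> is the form at the rational point, so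
    \<open>q (S - T)\<close> is a nonzero integer. As \<open>q \<bar>S\<bar> \<le> 1/2\<close>, the
    approximation errors collected in \<open>T\<close> must supply the other half.\<close>
  have "S - T = (\<Sum>j\<in>UNIV. real_of_int (r k i j) * real_of_int (v j) / real_of_int q)"
    unfolding S_def T_def sum_subtractf [symmetric] by (intro sum.cong) (simp_all add: algebra_simps)
  then have "real_of_int q * (S - T) = real_of_int (\<Sum>j\<in>UNIV. r k i j * v j)"
    using q by (simp add: sum_divide_distrib [symmetric])
  moreover have "1 \<le> \<bar>real_of_int (\<Sum>j\<in>UNIV. r k i j * v j)\<bar>" using i by linarith
  moreover have "real_of_int q * \<bar>S - T\<bar> = \<bar>real_of_int q * (S - T)\<bar>"
    using q by (simp add: abs_mult)
  ultimately have one: "1 \<le> real_of_int q * \<bar>S - T\<bar>" by (simp only:)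
  have "\<bar>S\<bar> \<le> 1 / L ^ k" unfolding S_def by (rule small[OF k_pos])
  then have "real_of_int q * \<bar>S\<bar> \<le> real_of_int q * (1 / L ^ k)"
    using q by (intro mult_left_mono) simp_all
  moreover have "L ^ k > 0" using assms(4) by simp
  then have "real_of_int q * (1 / L ^ k) \<le> 1 / 2" using k by (simp add: field_simps)
  ultimately have S: "real_of_int q * \<bar>S\<bar> \<le> 1 / 2" by (rule order_trans)
  have "\<bar>T\<bar> \<le> (\<Sum>j\<in>(UNIV :: 'n set). p * P ^ k * \<epsilon>)"
    unfolding T_def
  proof (intro order_trans[OF sum_abs] sum_mono)
    fix j
    show "\<bar>real_of_int (r k i j) * (\<theta> j - real_of_int (v j) / real_of_int q)\<bar> \<le> p * P ^ k * \<epsilon>"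
      unfolding abs_mult using coeff[OF k_pos, of i j] close[of j] assms(5,6) by (intro mult_mono) auto
  qed
  then have "\<bar>T\<bar> \<le> real CARD('n) * p * \<epsilon> * P ^ k" by (simp add: mult_ac)
  also have "\<dots> \<le> real CARD('n) * p * \<epsilon> * (P * (2 * real_of_int q) powr s)"
    using Pk assms(6) \<epsilon> by (intro mult_left_mono mult_nonneg_nonneg) auto
  finally have T: "real_of_int q * \<bar>T\<bar> \<le> real_of_int q * (real CARD('n) * p * \<epsilon> * (P * (2 * real_of_int q) powr s))"
    using q by (intro mult_left_mono) auto
  have "real_of_int q * \<bar>S - T\<bar> \<le> real_of_int q * (\<bar>S\<bar> + \<bar>T\<bar>)"
    using q by (intro mult_left_mono abs_triangle_ineq4) auto
  then have "1 \<le> 2 * (real_of_int q * (real CARD('n) * p * \<epsilon> * (P * (2 * real_of_int q) powr s)))"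
    using one S T unfolding distrib_left by linarith
  also have "\<dots> = 2 * real CARD('n) * p * P * (2 * real_of_int q) powr s * real_of_int q * \<epsilon>"
    by (simp only: mult.assoc mult.commute mult.left_commute)
  finally show ?thesis unfolding s_def .
qed

lemma pade_coeff_nondegenerate:
  fixes a :: "3 \<Rightarrow> real"
  assumes "inj a" "\<And>j. 1 + a j * x > 0" "x \<noteq> 0" "\<And>i. (\<Sum>j\<in>UNIV. pade_coeff a k x i j * v j) = 0"
  shows "v j = 0"
proof -
  \<comment> \<open>Parity: equality would mean \<open>2d + 3 = 4k\<close>.\<close>
  have "real k + 1/2 + 1 + real d \<noteq> real k * real CARD(3)" for d
  proof
    assume "real k + 1/2 + 1 + real d = real k * real CARD(3)"
    then have "real (2 * d + 3) = real (4 * k)" by simp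
    then have "2 * d + 3 = 4 * k" by (simp only: of_nat_eq_iff)
    then show False by presburger
  qed
  note left = pade_residue_left_kernel_trivial[OF assms(1-3) this]
  \<comment> \<open>The entries of the two matrices differ by a nonzero scaling of each column, so a
    kernel vector is rescaled accordingly.\<close>
  have "(\<Sum>j\<in>UNIV. pade_residue a k (real k + 1/2) x i j * (v j / sqrt (1 + a j * x))) = 0" for i
  proof -
    have "pade_residue a k (real k + 1/2) x i j * (v j / sqrt (1 + a j * x)) = pade_coeff a k x i j * v j" for j
      using pade_residue_eq[OF assms(1) assms(2)[of j], of k i] assms(2)[of j] by simp
    then show ?thesis using assms(4) by simp
  qed
  then have "v j / sqrt (1 + a j * x) = 0"
    by (rule trivial_left_kernel_imp_trivial_right_kernel[rotated]) (rule left)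
  then show ?thesis using assms(2)[of j] by simp
qed

lemma pade_form_bound:
  fixes a :: "3 \<Rightarrow> real"
  assumes "inj a" "\<And>j. 0 \<le> a j" "\<And>j. a j \<le> r" "0 \<le> x" "r * x < 1" "k > 0"
  shows "\<bar>\<Sum>j\<in>UNIV. pade_coeff a k x i j * sqrt (1 + a j * x)\<bar> \<le> (x ^ 3 / (3 * (1 - r * x)\<^sup>2)) ^ k"
proof -
  have r: "r \<ge> 0" using assms(2,3) order_trans by blast
  have pos: "1 + a j * x > 0" for j using assms(2)[of j] assms(4) by (simp add: add_pos_nonneg)
  have exps: "sum (pade_exponent k i) UNIV = Suc (3 * k)"
  proof -
    have "sum (pade_exponent k i) UNIV = (\<Sum>l\<in>(UNIV :: 3 set). k + (if l = i then 1 else 0))"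
      by (intro sum.cong) (auto simp: pade_exponent_def)
    then show ?thesis by (simp add: sum.distrib)
  qed
  have "(\<Sum>j\<in>UNIV. pade_coeff a k x i j * sqrt (1 + a j * x)) = binom_res_sum a (pade_exponent k i) (real k + 1/2) x"
    unfolding binom_res_sum_def pade_residue_def [symmetric] using pade_residue_eq[OF assms(1) pos] by simp
  also have "\<bar>\<dots>\<bar> \<le> \<bar>(real k + 1/2) gchoose (3 * k)\<bar> * x ^ (3 * k) * (1 - r * x) powr (real k + 1/2 - real (3 * k))"
    using assms exps by (intro binom_res_sum_bound) auto
  also have "\<dots> \<le> (1 / 3 ^ k) * x ^ (3 * k) * (1 / (1 - r * x) ^ (2 * k))"
  proof (intro mult_mono mult_right_mono)
    show "\<bar>(real k + 1/2) gchoose (3 * k)\<bar> \<le> 1 / 3 ^ k" using assms(6) by (rule abs_gbinomial_half_bound)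
    \<comment> \<open>The exponent is \<open>1/2 - 2k\<close>; since the base is at most 1, dropping
      the \<open>1/2\<close> only enlarges the power.\<close>
    have "(1 - r * x) powr (real k + 1/2 - real (3 * k)) \<le> (1 - r * x) powr (- real (2 * k))"
      using assms(4,5) r by (intro powr_mono') auto
    also have "\<dots> = 1 / (1 - r * x) ^ (2 * k)"
      using assms(5) by (simp only: powr_minus powr_realpow diff_gt_0_iff_gt inverse_eq_divide)
    finally show "(1 - r * x) powr (real k + 1/2 - real (3 * k)) \<le> 1 / (1 - r * x) ^ (2 * k)" .
  qed (use assms in auto)
  also have "\<dots> = (x ^ 3 / (3 * (1 - r * x)\<^sup>2)) ^ k"
    by (simp add: power_divide power_mult_distrib power_mult)
  finally show ?thesis .
qed

section \<open>The nodes 0, a1, a2\<close>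

definition three_nodes :: "int \<Rightarrow> int \<Rightarrow> 3 \<Rightarrow> int" where
  "three_nodes a1 a2 j = (if j = 1 then 0 else if j = 2 then a1 else a2)"

lemma three_nodes_simps [simp]:
  "three_nodes a1 a2 1 = 0" "three_nodes a1 a2 2 = a1" "three_nodes a1 a2 3 = a2"
  by (simp_all add: three_nodes_def)

context
  fixes a1 a2 N :: int
  assumes a1: "0 < a1" and a12: "a1 < a2" and N: "N > 0" and dvd: "a1 * a2 dvd N"
begin

lemma inj_three_nodes: "inj (\<lambda>j. real_of_int (three_nodes a1 a2 j))"
proof (rule injI)
  fix i j assume "real_of_int (three_nodes a1 a2 i) = real_of_int (three_nodes a1 a2 j)"
  then show "i = j" using exhaust_3[of i] exhaust_3[of j] a1 a12 by auto
qed

lemma three_nodes_bounds: "0 \<le> three_nodes a1 a2 j" "three_nodes a1 a2 j \<le> a2"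
  using exhaust_3[of j] a1 a12 by auto

text \<open>The order of \<open>l1\<close> and \<open>l2\<close> matters. For the nodes
  \<open>a1\<close> and \<open>a2\<close>, \<open>l1\<close> is the node 0, so that
  \<open>a j - a l1 = a j\<close> divides \<open>N + 4 * a j\<close>. For the node 0 both
  differences are available, because \<open>a1 * a2\<close> divides \<open>N\<close>.\<close>

lemma three_nodes_cases:
  fixes j :: 3
  defines "a \<equiv> three_nodes a1 a2" and "\<delta> \<equiv> min a1 (a2 - a1)" and "E \<equiv> a1 * a2 * (a2 - a1)\<^sup>2"
  obtains l1 l2 where "UNIV = {j, l1, l2}" "distinct [j, l1, l2]" "a j \<noteq> a l1" "a j \<noteq> a l2"
    "((a j - a l1) * (a j - a l2) dvd N + 4 * a j \<and> (a j - a l1) * (a j - a l2) dvd E)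
          \<or> ((a j - a l1) dvd N + 4 * a j \<and> (a j - a l1) * (a j - a l2) ^ 2 dvd E)"
    "\<delta> \<le> \<bar>a j - a l1\<bar>" "\<delta> \<le> \<bar>a j - a l2\<bar>" "a1 * (a2 - a1) \<le> \<bar>a j - a l1\<bar> * \<bar>a j - a l2\<bar>"
proof -
  note defs = a_def \<delta>_def E_def
  consider "j = 1" | "j = 2" | "j = 3" using exhaust_3[of j] by blast
  then show thesis
  proof cases
    case 1
    show thesis
    proof (rule that[of 2 3])
      show "((a j - a 2) * (a j - a 3) dvd N + 4 * a j \<and> (a j - a 2) * (a j - a 3) dvd E)
          \<or> ((a j - a 2) dvd N + 4 * a j \<and> (a j - a 2) * (a j - a 3) ^ 2 dvd E)"
        using dvd 1 by (simp add: defs)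
      show "a1 * (a2 - a1) \<le> \<bar>a j - a 2\<bar> * \<bar>a j - a 3\<bar>"
        using a1 a12 1 by (simp add: defs mult_left_mono)
      show "UNIV = {j, 2, 3}" unfolding 1 UNIV_3 by blast
      show "distinct [j, 2, 3]" using 1 by simp
      show "a j \<noteq> a 2" "a j \<noteq> a 3" "\<delta> \<le> \<bar>a j - a 2\<bar>" "\<delta> \<le> \<bar>a j - a 3\<bar>"
        using a1 a12 by (simp_all add: defs 1)
    qed
  next
    case 2
    show thesis
    proof (rule that[of 1 3])
      have "a1 dvd N" using dvd by (rule dvd_mult_left)
      then show "((a j - a 1) * (a j - a 3) dvd N + 4 * a j \<and> (a j - a 1) * (a j - a 3) dvd E)
          \<or> ((a j - a 1) dvd N + 4 * a j \<and> (a j - a 1) * (a j - a 3) ^ 2 dvd E)"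
        using 2 by (simp add: defs power2_commute[of a1] mult.assoc)
      show "a1 * (a2 - a1) \<le> \<bar>a j - a 1\<bar> * \<bar>a j - a 3\<bar>"
        using a1 a12 2 by (simp add: defs)
      show "UNIV = {j, 1, 3}" unfolding 2 UNIV_3 by blast
      show "distinct [j, 1, 3]" using 2 by simp
      show "a j \<noteq> a 1" "a j \<noteq> a 3" "\<delta> \<le> \<bar>a j - a 1\<bar>" "\<delta> \<le> \<bar>a j - a 3\<bar>"
        using a1 a12 by (simp_all add: defs 2)
    qed
  next
    case 3
    show thesis
    proof (rule that[of 1 2])
      have "a2 dvd N" using dvd by (rule dvd_mult_right)
      then show "((a j - a 1) * (a j - a 2) dvd N + 4 * a j \<and> (a j - a 1) * (a j - a 2) dvd E)
          \<or> ((a j - a 1) dvd N + 4 * a j \<and> (a j - a 1) * (a j - a 2) ^ 2 dvd E)"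
        using 3 by (simp add: defs mult.assoc)
      show "a1 * (a2 - a1) \<le> \<bar>a j - a 1\<bar> * \<bar>a j - a 2\<bar>"
        using a1 a12 3 by (simp add: defs)
      show "UNIV = {j, 1, 2}" unfolding 3 UNIV_3 by blast
      show "distinct [j, 1, 2]" using 3 by simp
      show "a j \<noteq> a 1" "a j \<noteq> a 2" "\<delta> \<le> \<bar>a j - a 1\<bar>" "\<delta> \<le> \<bar>a j - a 2\<bar>"
        using a1 a12 by (simp_all add: defs 3)
    qed
  qed
qed

definition pade_denominator :: "nat \<Rightarrow> int" where
  "pade_denominator k = (N * (a1 * a2 * (a2 - a1)\<^sup>2)) ^ k"

text \<open>The floor only serves to obtain the type \<open>int\<close>; the number inside is
  already an integer.\<close>

definition pade_int :: "nat \<Rightarrow> 3 \<Rightarrow> 3 \<Rightarrow> int" where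
  "pade_int k i j = \<lfloor>real_of_int (pade_denominator k)
     * pade_coeff (\<lambda>l. real_of_int (three_nodes a1 a2 l)) k (4 / real_of_int N) i j\<rfloor>"

lemma pade_denominator_pos: "pade_denominator k > 0"
  using a1 a12 N by (simp add: pade_denominator_def)

lemma of_int_pade_int:
  "real_of_int (pade_int k i j) = real_of_int (pade_denominator k)
     * pade_coeff (\<lambda>l. real_of_int (three_nodes a1 a2 l)) k (4 / real_of_int N) i j"
proof -
  obtain l1 l2 where l: "UNIV = {j, l1, l2}" "distinct [j, l1, l2]"
    "three_nodes a1 a2 j \<noteq> three_nodes a1 a2 l1" "three_nodes a1 a2 j \<noteq> three_nodes a1 a2 l2"
    "((three_nodes a1 a2 j - three_nodes a1 a2 l1) * (three_nodes a1 a2 j - three_nodes a1 a2 l2) dvd N + 4 * three_nodes a1 a2 j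
        \<and> (three_nodes a1 a2 j - three_nodes a1 a2 l1) * (three_nodes a1 a2 j - three_nodes a1 a2 l2) dvd a1 * a2 * (a2 - a1)\<^sup>2)
      \<or> ((three_nodes a1 a2 j - three_nodes a1 a2 l1) dvd N + 4 * three_nodes a1 a2 j
        \<and> (three_nodes a1 a2 j - three_nodes a1 a2 l1) * (three_nodes a1 a2 j - three_nodes a1 a2 l2) ^ 2 dvd a1 * a2 * (a2 - a1)\<^sup>2)"
    by (rule three_nodes_cases)
  from pade_coeff_Ints[OF l(1-4) N l(5), of k i] show ?thesis
    unfolding pade_int_def pade_denominator_def by (elim Ints_cases) (simp only: floor_of_int)
qed

lemma pade_int_nondegenerate:
  assumes "v l \<noteq> 0"
  shows "\<exists>i. (\<Sum>j\<in>UNIV. pade_int k i j * v j) \<noteq> 0"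
proof (rule ccontr)
  assume "\<nexists>i. (\<Sum>j\<in>UNIV. pade_int k i j * v j) \<noteq> 0"
  then have "real_of_int (\<Sum>j\<in>UNIV. pade_int k i j * v j) = 0" for i by simp
  then have "real_of_int (pade_denominator k) * (\<Sum>j\<in>UNIV. pade_coeff (\<lambda>l. real_of_int (three_nodes a1 a2 l)) k
      (4 / real_of_int N) i j * real_of_int (v j)) = 0" for i
    by (simp add: of_int_pade_int sum_distrib_left mult.assoc)
  then have "(\<Sum>j\<in>UNIV. pade_coeff (\<lambda>l. real_of_int (three_nodes a1 a2 l)) k (4 / real_of_int N) i j * real_of_int (v j)) = 0" for i
    using pade_denominator_pos[of k] by simp
  moreover have "1 + real_of_int (three_nodes a1 a2 j) * (4 / real_of_int N) > 0" for j
    using three_nodes_bounds(1)[of j] N by (intro add_pos_nonneg mult_nonneg_nonneg) auto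
  ultimately have "real_of_int (v l) = 0"
    using N by (intro pade_coeff_nondegenerate[OF inj_three_nodes, where v = "\<lambda>j. real_of_int (v j)"
        and k = k and x = "4 / real_of_int N" and j = l]) auto
  then show False using assms by simp
qed

lemma pade_int_bound:
  defines "y \<equiv> 4 * real_of_int a2 / real_of_int N"
  shows "\<bar>real_of_int (pade_int k i j)\<bar> \<le> real (Suc k) * (1 + y) ^ (2 * k + 1)
           * (8 * real_of_int (max a1 (a2 - a1)) * a2 * N / a1) ^ k"
proof -
  let ?\<delta> = "min a1 (a2 - a1)" and ?Q = "max a1 (a2 - a1)"
  obtain l1 l2 where l: "UNIV = {j, l1, l2}" "distinct [j, l1, l2]"
    "three_nodes a1 a2 j \<noteq> three_nodes a1 a2 l1" "three_nodes a1 a2 j \<noteq> three_nodes a1 a2 l2"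
    "?\<delta> \<le> \<bar>three_nodes a1 a2 j - three_nodes a1 a2 l1\<bar>" "?\<delta> \<le> \<bar>three_nodes a1 a2 j - three_nodes a1 a2 l2\<bar>"
    "a1 * (a2 - a1) \<le> \<bar>three_nodes a1 a2 j - three_nodes a1 a2 l1\<bar> * \<bar>three_nodes a1 a2 j - three_nodes a1 a2 l2\<bar>"
    by (rule three_nodes_cases)
  have y: "y = real_of_int a2 * (4 / real_of_int N)" by (simp add: y_def)
  have "\<bar>pade_coeff (\<lambda>l. real_of_int (three_nodes a1 a2 l)) k (4 / real_of_int N) i j\<bar>
      \<le> real (Suc k) * 8 ^ k / (real_of_int (a1 * (a2 - a1)) * real_of_int ?\<delta>) ^ k
          * (1 + real_of_int a2 * (4 / real_of_int N)) ^ (2 * k + 1)"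
  proof (rule pade_coeff_bound[OF l(1-4)])
    show "real_of_int (a1 * (a2 - a1)) \<le> \<bar>real_of_int (three_nodes a1 a2 j - three_nodes a1 a2 l1)\<bar>
        * \<bar>real_of_int (three_nodes a1 a2 j - three_nodes a1 a2 l2)\<bar>"
      using l(7) by (metis of_int_abs of_int_le_iff of_int_mult)
    show "real_of_int ?\<delta> \<le> \<bar>real_of_int (three_nodes a1 a2 j - three_nodes a1 a2 l1)\<bar>"
      using l(5) by (metis of_int_abs of_int_le_iff)
    show "real_of_int ?\<delta> \<le> \<bar>real_of_int (three_nodes a1 a2 j - three_nodes a1 a2 l2)\<bar>"
      using l(6) by (metis of_int_abs of_int_le_iff)
    show "0 < real_of_int (a1 * (a2 - a1))" using a1 a12 by (metis of_int_0_less_iff diff_gt_0_iff_gt mult_pos_pos)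
    show "0 < real_of_int ?\<delta>" "real_of_int ?\<delta> \<le> real_of_int a2" using a1 a12 by auto
    show "0 \<le> three_nodes a1 a2 j" "real_of_int (three_nodes a1 a2 j) \<le> real_of_int a2"
      using three_nodes_bounds[of j] by auto
    show "0 \<le> 4 / real_of_int N" using N by simp
  qed
  then have "real_of_int (pade_denominator k) * \<bar>pade_coeff (\<lambda>l. real_of_int (three_nodes a1 a2 l)) k (4 / real_of_int N) i j\<bar>
      \<le> real_of_int (pade_denominator k) *
      (real (Suc k) * 8 ^ k / (real_of_int (a1 * (a2 - a1)) * real_of_int ?\<delta>) ^ k * (1 + y) ^ (2 * k + 1))"
    unfolding y using pade_denominator_pos[of k] by (intro mult_left_mono) auto
  moreover have "\<bar>real_of_int (pade_int k i j)\<bar>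
      = real_of_int (pade_denominator k) * \<bar>pade_coeff (\<lambda>l. real_of_int (three_nodes a1 a2 l)) k (4 / real_of_int N) i j\<bar>"
    unfolding of_int_pade_int abs_mult using pade_denominator_pos[of k] by simp
  moreover have "real_of_int (pade_denominator k) *
      (real (Suc k) * 8 ^ k / (real_of_int (a1 * (a2 - a1)) * real_of_int ?\<delta>) ^ k * (1 + y) ^ (2 * k + 1))
    = real (Suc k) * (1 + y) ^ (2 * k + 1)
      * (8 * real_of_int (N * (a1 * a2 * (a2 - a1)\<^sup>2)) / (real_of_int (a1 * (a2 - a1)) * real_of_int ?\<delta>)) ^ k"
  proof -
    have "D ^ k * (u * 8 ^ k / g ^ k * w) = u * w * (8 * D / g) ^ k" for D u g w :: real
      by (simp add: power_divide power_mult_distrib)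
    then show ?thesis unfolding pade_denominator_def of_int_power .
  qed
  moreover have "8 * real_of_int (N * (a1 * a2 * (a2 - a1)\<^sup>2)) / (real_of_int (a1 * (a2 - a1)) * real_of_int ?\<delta>)
      = 8 * real_of_int ?Q * a2 * N / a1"
  proof -
    have pos: "real_of_int a1 > 0" "real_of_int (a2 - a1) > 0" "real_of_int ?\<delta> > 0" using a1 a12 by auto
    \<comment> \<open>This identity simplifies \<open>E / (a1 (a2 - a1) \<delta>)\<close>, with
      \<open>E = a1 a2 (a2 - a1)^2\<close>, to \<open>a2 Q / a1\<close>, and so produces the max in
      \<open>a1'\<close>.\<close>
    have "?\<delta> * ?Q = a1 * (a2 - a1)" by (simp add: min_def max_def)
    then have "real_of_int ?\<delta> * real_of_int ?Q = real_of_int a1 * real_of_int (a2 - a1)"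
      by (metis of_int_mult)
    then have Q: "real_of_int ?Q = real_of_int a1 * real_of_int (a2 - a1) / real_of_int ?\<delta>"
      using pos by (simp add: field_simps)
    have "8 * (n * (a * c * b\<^sup>2)) / (a * b * d) = 8 * (a * b / d) * c * n / a"
      if "a > 0" "b > 0" "d > 0" for a b c d n :: real
      using that by (simp add: field_simps power2_eq_square)
    from this[OF pos] show ?thesis unfolding Q of_int_mult of_int_power .
  qed
  ultimately show ?thesis by (simp only:)
qed

lemma pade_int_form_bound:
  defines "y \<equiv> 4 * real_of_int a2 / real_of_int N"
  assumes "y < 1" "k > 0"
  shows "\<bar>\<Sum>j\<in>UNIV. real_of_int (pade_int k i j) * sqrt (1 + 4 * real_of_int (three_nodes a1 a2 j) / real_of_int N)\<bar>
     \<le> (64 * real_of_int (a1 * a2 * (a2 - a1)\<^sup>2) / (3 * (1 - y)\<^sup>2 * real_of_int N ^ 2)) ^ k"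
proof -
  let ?x = "4 / real_of_int N" and ?a = "\<lambda>l. real_of_int (three_nodes a1 a2 l)"
  have y: "y = real_of_int a2 * ?x" by (simp add: y_def)
  have "(\<Sum>j\<in>UNIV. real_of_int (pade_int k i j) * sqrt (1 + 4 * ?a j / real_of_int N))
      = real_of_int (pade_denominator k) * (\<Sum>j\<in>UNIV. pade_coeff ?a k ?x i j * sqrt (1 + ?a j * ?x))"
    by (simp add: of_int_pade_int sum_distrib_left mult_ac)
  also have "\<bar>\<dots>\<bar> \<le> real_of_int (pade_denominator k) * (?x ^ 3 / (3 * (1 - y)\<^sup>2)) ^ k"
  proof -
    have "\<bar>\<Sum>j\<in>UNIV. pade_coeff ?a k ?x i j * sqrt (1 + ?a j * ?x)\<bar> \<le> (?x ^ 3 / (3 * (1 - real_of_int a2 * ?x)\<^sup>2)) ^ k"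
      using three_nodes_bounds N assms(2,3) y
      by (intro pade_form_bound[OF inj_three_nodes]) auto
    then show ?thesis using pade_denominator_pos[of k] unfolding y abs_mult by (simp add: mult_left_mono)
  qed
  also have "\<dots> = (real_of_int (N * (a1 * a2 * (a2 - a1)\<^sup>2)) * (?x ^ 3 / (3 * (1 - y)\<^sup>2))) ^ k"
    unfolding pade_denominator_def by (simp only: of_int_power power_mult_distrib [symmetric])
  also have "real_of_int (N * (a1 * a2 * (a2 - a1)\<^sup>2)) * (?x ^ 3 / (3 * (1 - y)\<^sup>2))
      = 64 * real_of_int (a1 * a2 * (a2 - a1)\<^sup>2) / (3 * (1 - y)\<^sup>2 * real_of_int N ^ 2)"
  proof -
    have "n * e * ((4 / n) ^ 3 / (3 * z)) = 64 * e / (3 * z * n ^ 2)" if "n \<noteq> 0" for n e z :: real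
      using that by (cases "z = 0") (simp_all add: field_simps power2_eq_square power3_eq_cube)
    then show ?thesis using N by (simp only: of_int_mult)
  qed
  finally show ?thesis .
qed

end

text \<open>Bernoulli's inequality with step 1/8 trades \<open>k + 1\<close> for
  \<open>8 * 1.125 ^ k\<close>; then \<open>1.125 * 1.1 = 1.2375\<close> fits under
  \<open>1.250394\<close> and \<open>8 * 1.1\<close> under 9.\<close>

lemma Suc_mult_power_le:
  assumes "0 \<le> y" "(1 + y)\<^sup>2 \<le> (1.1 :: real)"
  shows "real (Suc k) * (1 + y) ^ (2 * k + 1) \<le> 9 * 1.250394 ^ k"
proof -
  have "1 + y \<le> (1 + y)\<^sup>2" using assms(1) by (simp add: power2_eq_square algebra_simps)
  then have y: "1 + y \<le> 1.1" using assms(2) by simp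
  have "1 + real k * 0.125 \<le> (1 + 0.125) ^ k" by (rule Bernoulli_inequality) simp
  then have Suc_k: "real (Suc k) \<le> 8 * 1.125 ^ k" by simp
  have "(1 + y) ^ (2 * k + 1) = ((1 + y)\<^sup>2) ^ k * (1 + y)" by (simp add: power_mult)
  also have "\<dots> \<le> 1.1 ^ k * 1.1" using assms y by (intro mult_mono power_mono) auto
  finally have "real (Suc k) * (1 + y) ^ (2 * k + 1) \<le> (8 * 1.125 ^ k) * (1.1 ^ k * 1.1)"
    using Suc_k assms(1) by (intro mult_mono) auto
  also have "\<dots> = 8.8 * (1.125 * 1.1) ^ k" by (simp only: power_mult_distrib)
  also have "\<dots> \<le> 9 * 1.250394 ^ k" by (intro mult_mono power_mono) auto
  finally show ?thesis .
qed

theorem mainTheorem6: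
  fixes a1 a2 N :: int
  assumes "0 < a1" and "a1 \<le> a2 - 2" and "a2 \<ge> 3"
    and "N > 0" and "(a1 * a2) dvd N"
    and "real_of_int N \<ge> 396.59 * real_of_int (max (4 * (a2 - a1)) (4 * a1))
                          * real_of_int a2 ^ 2 * real_of_int (a2 - a1) ^ 2"
  shows "let a1' = real_of_int (max (4 * (a2 - a1)) (4 * a1));
             th1 = sqrt (1 + 4 * real_of_int a2 / real_of_int N);
             th2 = sqrt (1 + 4 * real_of_int a1 / real_of_int N);
             lam = 1 + ln (2.500788 * a1' * real_of_int a2 * real_of_int N / real_of_int a1)
                   / ln (0.04216 * real_of_int N ^ 2
                          / (real_of_int a1 * real_of_int a2 * real_of_int (a2 - a1) ^ 2))
         in lam < 2 \<and>
            (\<forall>p1 p2 q :: int. q > 0 \<longrightarrow>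
               max \<bar>th1 - real_of_int p1 / real_of_int q\<bar> \<bar>th2 - real_of_int p2 / real_of_int q\<bar>
               > real_of_int a1 / (3.53081 * 10 ^ 27 * a1' * real_of_int a2 * real_of_int N)
                 * real_of_int q powr (- lam))"
proof -
  define A1 A2 n b Q where "A1 = real_of_int a1" and "A2 = real_of_int a2" and "n = real_of_int N"
    and "b = real_of_int (a2 - a1)" and "Q = real_of_int (max a1 (a2 - a1))"
  note defs = A1_def A2_def n_def b_def Q_def
  have a1': "real_of_int (max (4 * (a2 - a1)) (4 * a1)) = 4 * Q" by (simp add: Q_def max_def)
  have a12: "a1 < a2" using assms(2) by simp
  have ge: "A1 \<ge> 1" "A2 \<ge> 3" "b \<ge> 2" "Q \<ge> 1" "Q \<ge> A1" "n > 0" "A1 \<le> A2"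
    using assms(1-4) by (auto simp: defs)
  have n_ge: "n \<ge> 1586 * (Q * A2\<^sup>2 * b\<^sup>2)"
  proof -
    have "1586 * (Q * A2\<^sup>2 * b\<^sup>2) \<le> 396.59 * (4 * Q) * A2 ^ 2 * b ^ 2" using ge by simp
    then show ?thesis using assms(6) unfolding a1' defs by linarith
  qed
  define y where "y = 4 * A2 / n"
  have "1 * 3 * 4 \<le> Q * A2 * b\<^sup>2"
    using ge by (intro mult_mono) (auto simp: power2_eq_square intro: mult_mono[of 2 b 2 b, simplified])
  then have "A2 * 12 \<le> A2 * (Q * A2 * b\<^sup>2)" using ge by (intro mult_left_mono) auto
  then have "n \<ge> 19032 * A2" using n_ge by (simp add: power2_eq_square algebra_simps)
  then have y: "0 \<le> y" "y \<le> 1 / 1000" using ge by (auto simp: y_def field_simps)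
  have y_sq: "(1 + y)\<^sup>2 \<le> 1.1" "(1 - y)\<^sup>2 \<ge> 0.9" "(1 - y)\<^sup>2 > 0"
  proof -
    have "y * y \<le> 1 / 1000 * (1 / 1000)" "y * y \<ge> 0" using y by (intro mult_mono mult_nonneg_nonneg; simp)+
    moreover have "(1 + y)\<^sup>2 = 1 + 2 * y + y * y" "(1 - y)\<^sup>2 = 1 - 2 * y + y * y"
      by (simp_all add: power2_eq_square algebra_simps)
    ultimately show "(1 + y)\<^sup>2 \<le> 1.1" "(1 - y)\<^sup>2 \<ge> 0.9" "(1 - y)\<^sup>2 > 0"
      using y by linarith+
  qed
  define P where "P = 2.500788 * (4 * Q) * A2 * n / A1"
  define L where "L = 0.04216 * n ^ 2 / (A1 * A2 * b ^ 2)"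
  define s where "s = ln P / ln L"
  have E_pos: "A1 * A2 * b\<^sup>2 > 0" using ge by auto
  have P: "P \<ge> 1"
  proof -
    have "A1 * 1 \<le> A2 * n" using ge assms(4) by (intro mult_mono) (auto simp: n_def)
    also have "\<dots> \<le> (2.500788 * (4 * Q)) * (A2 * n)"
      using ge mult_right_mono[of 1 "2.500788 * (4 * Q)" "A2 * n"] by simp
    finally show ?thesis using ge by (simp add: P_def)
  qed
  \<comment> \<open>After clearing denominators this is
    \<open>10.003152 Q a2^2 b^2 < 0.04216 N\<close>, and the lower bound on \<open>N\<close> is
    where it comes from. It is equivalent to \<open>lam < 2\<close> once
    \<open>L > 1\<close>.\<close>
  have PL: "P < L"
  proof -
    have "10.003152 * (Q * A2\<^sup>2 * b\<^sup>2) < 0.04216 * n"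
      using n_ge mult_pos_pos[of "Q * A2\<^sup>2" "b\<^sup>2"] ge by (simp add: mult_pos_pos)
    then have "10.003152 * (Q * A2\<^sup>2 * b\<^sup>2) * n < 0.04216 * n * n"
      using ge by (intro mult_strict_right_mono) auto
    then show ?thesis using ge E_pos by (simp add: P_def L_def field_simps power2_eq_square)
  qed
  then have L: "L > 1" using P by simp
  have s: "0 \<le> s" "s < 1" using P PL L by (auto simp: s_def)
  have main: "A1 / (3.53081 * 10 ^ 27 * (4 * Q) * A2 * n) * real_of_int q powr (- (1 + s))
      < max \<bar>sqrt (1 + 4 * A2 / n) - real_of_int p1 / real_of_int q\<bar> \<bar>sqrt (1 + 4 * A1 / n) - real_of_int p2 / real_of_int q\<bar>"
    (is "_ < ?\<epsilon>") if q: "q > 0" for p1 p2 q :: int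
  proof -
    \<comment> \<open>The node 0 carries the number 1, approximated exactly by \<open>q / q\<close>;
      \<open>p2\<close> belongs to \<open>a1\<close> and \<open>p1\<close> to
      \<open>a2\<close>.\<close>
    define v :: "3 \<Rightarrow> int" where "v = (\<lambda>j. if j = 1 then q else if j = 2 then p2 else p1)"
    define \<theta> where "\<theta> = (\<lambda>j. sqrt (1 + 4 * real_of_int (three_nodes a1 a2 j) / n))"
    have coeff: "\<bar>real_of_int (pade_int a1 a2 N k i j)\<bar> \<le> 9 * P ^ k" for k i j
    proof -
      have P_eq: "P = 1.250394 * (8 * Q * A2 * n / A1)" by (simp add: P_def)
      have "\<bar>real_of_int (pade_int a1 a2 N k i j)\<bar>
          \<le> real (Suc k) * (1 + y) ^ (2 * k + 1) * (8 * Q * A2 * n / A1) ^ k"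
        using pade_int_bound[OF assms(1) a12 assms(4,5), of k i j] by (simp only: y_def defs)
      also have "\<dots> \<le> (9 * 1.250394 ^ k) * (8 * Q * A2 * n / A1) ^ k"
        using Suc_mult_power_le[OF y(1) y_sq(1)] ge by (intro mult_right_mono) auto
      also have "\<dots> = 9 * P ^ k" unfolding P_eq power_mult_distrib by (simp only: mult.assoc)
      finally show ?thesis .
    qed
    have small: "\<bar>\<Sum>j\<in>UNIV. real_of_int (pade_int a1 a2 N k i j) * \<theta> j\<bar> \<le> 1 / L ^ k" if "k > 0" for k i
    proof -
      have "\<bar>\<Sum>j\<in>UNIV. real_of_int (pade_int a1 a2 N k i j) * \<theta> j\<bar>
          \<le> (64 * (A1 * A2 * b\<^sup>2) / (3 * (1 - y)\<^sup>2 * n\<^sup>2)) ^ k"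
        using pade_int_form_bound[OF assms(1) a12 assms(4,5) _ that, of i] y
        by (simp add: \<theta>_def y_def defs)
      also have "\<dots> \<le> (1 / L) ^ k"
      proof (rule power_mono)
        have "64 * (A1 * A2 * b\<^sup>2) / (3 * (1 - y)\<^sup>2 * n\<^sup>2) = (64 / (3 * (1 - y)\<^sup>2)) * ((A1 * A2 * b\<^sup>2) / n\<^sup>2)"
          by simp
        also have "\<dots> \<le> (1 / 0.04216) * ((A1 * A2 * b\<^sup>2) / n\<^sup>2)"
        proof (rule mult_right_mono)
          \<comment> \<open>A narrow fit: \<open>64 / 2.7\<close> is about 23.704 and
            \<open>1 / 0.04216\<close> about 23.719.\<close>
          show "64 / (3 * (1 - y)\<^sup>2) \<le> 1 / 0.04216" using y_sq(2,3) by (simp add: field_simps)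
          show "0 \<le> A1 * A2 * b\<^sup>2 / n\<^sup>2" using E_pos by simp
        qed
        also have "\<dots> = 1 / L" by (simp add: L_def)
        finally show "64 * (A1 * A2 * b\<^sup>2) / (3 * (1 - y)\<^sup>2 * n\<^sup>2) \<le> 1 / L" .
        show "0 \<le> 64 * (A1 * A2 * b\<^sup>2) / (3 * (1 - y)\<^sup>2 * n\<^sup>2)"
          using E_pos y_sq(3) ge by (intro divide_nonneg_nonneg mult_nonneg_nonneg) auto
      qed
      finally show ?thesis by (simp add: power_divide)
    qed
    have nondegenerate: "\<exists>i. (\<Sum>j\<in>UNIV. pade_int a1 a2 N k i j * v j) \<noteq> 0" for k
      using q by (intro pade_int_nondegenerate[OF assms(1) a12 assms(4,5), of v 1]) (simp add: v_def)
    have close: "\<bar>\<theta> j - real_of_int (v j) / real_of_int q\<bar> \<le> ?\<epsilon>" for j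
      using exhaust_3[of j] q by (auto simp: \<theta>_def v_def A1_def A2_def le_max_iff_disj)
    have "1 \<le> 2 * real CARD(3) * 9 * P * (2 * real_of_int q) powr s * real_of_int q * ?\<epsilon>"
      unfolding s_def
      by (rule simultaneous_approximation_bound[where r = "pade_int a1 a2 N" and v = v and \<theta> = \<theta>,
            OF coeff small nondegenerate L P _ q close]) simp_all
    also have "\<dots> = 54 * P * (2 powr s * real_of_int q powr s) * real_of_int q * ?\<epsilon>"
      using q by (simp add: powr_mult)
    also have "\<dots> \<le> 54 * P * (2 * real_of_int q powr s) * real_of_int q * ?\<epsilon>"
    proof -
      \<comment> \<open>Here \<open>s < 1\<close> enters; the constant becomes
        \<open>2 * 3 * 9 * 2 = 108\<close>.\<close>
      have "2 powr s \<le> (2::real) powr 1" using s by (intro powr_mono) auto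
      then show ?thesis using P q by (intro mult_right_mono mult_left_mono) (auto simp: le_max_iff_disj)
    qed
    also have "\<dots> = 108 * P * real_of_int q powr (1 + s) * ?\<epsilon>"
      using q by (simp add: powr_add)
    finally have "1 \<le> 108 * P * real_of_int q powr (1 + s) * ?\<epsilon>" .
    moreover have "inverse w / (108 * u) \<le> e" if "1 \<le> 108 * u * w * e" "w > 0" "u > 0" for u w e :: real
      using that by (simp add: field_simps)
    ultimately have "real_of_int q powr (- (1 + s)) / (108 * P) \<le> ?\<epsilon>"
      unfolding powr_minus using P q by simp
    moreover have "A1 / (3.53081 * 10 ^ 27 * (4 * Q) * A2 * n) * real_of_int q powr (- (1 + s))
        < real_of_int q powr (- (1 + s)) / (108 * P)"
    proof -
      have "A1 / (3.53081 * 10 ^ 27 * (4 * Q) * A2 * n) = (2.500788 / (3.53081 * 10 ^ 27)) * (1 / P)"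
        using ge by (simp add: P_def field_simps)
      \<comment> \<open>The factor \<open>2.500788\<close> comes from \<open>P\<close>; against
        \<open>3.53081 * 10 ^ 27\<close> the constant 108 leaves an enormous margin.\<close>
      also have "\<dots> < (1 / 108) * (1 / P)" using P by (intro mult_strict_right_mono) auto
      finally have "A1 / (3.53081 * 10 ^ 27 * (4 * Q) * A2 * n) * real_of_int q powr (- (1 + s))
          < (1 / 108) * (1 / P) * real_of_int q powr (- (1 + s))"
        using q by (intro mult_strict_right_mono) auto
      then show ?thesis by simp
    qed
    ultimately show ?thesis by linarith
  qed
  show ?thesis
    unfolding Let_def a1' A1_def [symmetric] A2_def [symmetric] n_def [symmetric] b_def [symmetric]
      P_def [symmetric] L_def [symmetric] s_def [symmetric]
    using s(2) main by auto
qed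

end
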